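(* Let $X$ be a Banach space with property $( * )$, $Y\subset X$ a closed subset, and $f:Y\to\mathbb{R}$ a function satisfying condition (E) for some continuous $D:Y\to Z^*$. Let $F:X\to\mathbb{R}$ be a continuous extension of $f$. Then for every $\varepsilon>0$ there is a $\mathcal{C}^1$-smooth $G:X\to\mathbb{R}$ such that, with $g=G|_Y$, (i) $|F(x)-G(x)|<\varepsilon$ for all $x\in X$; (ii) $\|D(y)-G'(y)|_Z\|_{Z^*}<\varepsilon$ for all $y\in Y$, and $\operatorname{Lip}(f-g)<\varepsilon$; (iii) furthermore, if $f$ is Lipschitz on $Y$, $F$ is a Lipschitz extension of $f$ to $X$, and $M:=\sup_{y\in Y}\|D(y)\|_{Z^*}<\infty$, then $G$ can be chosen, in addition to (i) and (ii), Lipschitz on $X$ with $\operatorname{Lip}(G)\le\frac{\varepsilon}{4}+(1+C_1)M+C_1\operatorname{Lip}(F)$, where $C_1\ge C_0$ is a constant depending only on $X$ (the constant such that for every $Y'\subset X$, every Lipschitz $F':X\to\mathbb{R}$ and every $\varepsilon'>0$ there is a $\mathcal{C}^1$-smooth Lipschitz $G'$ with $|F'-G'|\le\varepsilon'$, $\operatorname{Lip}(G'|_{Y'})\le C_0\operatorname{Lip}(F'|_{Y'})$, $\|(G')'(y)\|\le C_0\operatorname{Lip}(F'|_{Y'})$ on $Y'$, and $\operatorname{Lip}(G')\le C_1\operatorname{Lip}(F')$).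
   Context: A Banach space $X$ has property $( * )$ if there is a constant $C_0$, depending only on $X$, such that for every Lipschitz function $f:X\to\mathbb{R}$ and every $\varepsilon>0$ there is a Lipschitz, $\mathcal{C}^1$-smooth function $K:X\to\mathbb{R}$ with $|f(x)-K(x)|<\varepsilon$ for all $x\in X$ and $\operatorname{Lip}(K)\le C_0\operatorname{Lip}(f)$. For a closed subset $Y\subset X$, let $Z:=\overline{\operatorname{span}}\{y-y':y,y'\in Y\}$. Given $f:Y\to\mathbb{R}$ and a continuous map $D:Y\to Z^*$, $f$ satisfies condition (E) for $D$ if: for every $y\in Y$ and every $\varepsilon>0$ there is $r>0$ such that $|f(z)-f(w)-D(y)(z-w)|\le\varepsilon\|z-w\|$ for all $z,w\in Y\cap B(y,r)$. *)

theory Defs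
  imports "HOL-Analysis.Analysis"
begin

text \<open>Lipschitz constant of a real-valued function on a set S (the 0 makes the
  supremum well-defined for sets with fewer than two points; only used for
  Lipschitz functions).\<close>
definition lip :: "'a::metric_space set \<Rightarrow> ('a \<Rightarrow> real) \<Rightarrow> real" where
  "lip S f = Sup (insert 0 {dist (f x) (f y) / dist x y | x y. x \<in> S \<and> y \<in> S \<and> x \<noteq> y})"

definition C1_deriv :: "('a::real_normed_vector \<Rightarrow> real) \<Rightarrow> ('a \<Rightarrow> 'a \<Rightarrow>\<^sub>L real) \<Rightarrow> bool" where
  "C1_deriv G G' \<longleftrightarrow> (\<forall>x. (G has_derivative blinfun_apply (G' x)) (at x)) \<and> continuous_on UNIV G'"

definition C1_smooth :: "('a::real_normed_vector \<Rightarrow> real) \<Rightarrow> bool" where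
  "C1_smooth G \<longleftrightarrow> (\<exists>G'. C1_deriv G G')"

definition star_const :: "'a::real_normed_vector itself \<Rightarrow> real \<Rightarrow> bool" where
  "star_const _ C0 \<longleftrightarrow> (\<forall>(f::'a \<Rightarrow> real) L e. L-lipschitz_on UNIV f \<and> e > 0 \<longrightarrow>
      (\<exists>K. C1_smooth K \<and> (\<exists>LK. LK-lipschitz_on UNIV K) \<and> (\<forall>x. \<bar>f x - K x\<bar> < e) \<and>
           (C0 * lip UNIV f)-lipschitz_on UNIV K))"

definition has_property_star :: "'a::real_normed_vector itself \<Rightarrow> bool" where
  "has_property_star T \<longleftrightarrow> (\<exists>C0. star_const T C0)"

definition Zsp :: "'a::real_normed_vector set \<Rightarrow> 'a set" where
  "Zsp Y = closure (span {y - y' | y y'. y \<in> Y \<and> y' \<in> Y})"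

text \<open>phi (only its values on Z matter) is an element of Z^*.\<close>
definition in_dual :: "'a::real_normed_vector set \<Rightarrow> ('a \<Rightarrow> real) \<Rightarrow> bool" where
  "in_dual Z \<phi> \<longleftrightarrow> (\<forall>u\<in>Z. \<forall>v\<in>Z. \<phi> (u + v) = \<phi> u + \<phi> v) \<and>
     (\<forall>u\<in>Z. \<forall>c. \<phi> (c *\<^sub>R u) = c * \<phi> u) \<and> (\<exists>B. \<forall>z\<in>Z. \<bar>\<phi> z\<bar> \<le> B * norm z)"

definition dual_norm :: "'a::real_normed_vector set \<Rightarrow> ('a \<Rightarrow> real) \<Rightarrow> real" where
  "dual_norm Z \<phi> = Sup (insert 0 {\<bar>\<phi> z\<bar> | z. z \<in> Z \<and> norm z \<le> 1})"

definition cont_dual_map :: "'a::real_normed_vector set \<Rightarrow> ('a \<Rightarrow> 'a \<Rightarrow> real) \<Rightarrow> bool" where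
  "cont_dual_map Y D \<longleftrightarrow> (\<forall>y\<in>Y. in_dual (Zsp Y) (D y)) \<and>
     (\<forall>y\<in>Y. \<forall>e>0. \<exists>d>0. \<forall>y'\<in>Y. dist y' y < d \<longrightarrow> dual_norm (Zsp Y) (\<lambda>z. D y' z - D y z) < e)"

definition condE :: "'a::real_normed_vector set \<Rightarrow> ('a \<Rightarrow> real) \<Rightarrow> ('a \<Rightarrow> 'a \<Rightarrow> real) \<Rightarrow> bool" where
  "condE Y f D \<longleftrightarrow> (\<forall>y\<in>Y. \<forall>e>0. \<exists>r>0. \<forall>z\<in>Y \<inter> ball y r. \<forall>w\<in>Y \<inter> ball y r.
      \<bar>f z - f w - D y (z - w)\<bar> \<le> e * norm (z - w))"

definition C1_prop :: "'a::real_normed_vector itself \<Rightarrow> real \<Rightarrow> real \<Rightarrow> bool" where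
  "C1_prop _ C0 C1 \<longleftrightarrow> (\<forall>(Y'::'a set) (F'::'a \<Rightarrow> real) L e'. L-lipschitz_on UNIV F' \<and> e' > 0 \<longrightarrow>
     (\<exists>G' DG'. C1_deriv G' DG' \<and> (\<forall>x. \<bar>F' x - G' x\<bar> \<le> e') \<and>
        (C0 * lip Y' F')-lipschitz_on Y' G' \<and>
        (\<forall>y\<in>Y'. norm (DG' y) \<le> C0 * lip Y' F') \<and>
        (C1 * lip UNIV F')-lipschitz_on UNIV G'))"

end

theory Submission
  imports Defs
begin

text \<open>
  Near a point \<open>p\<close> of \<open>Y\<close>, condition (E) says that \<open>f - T\<close> has a small Lipschitz constant on \<open>Y\<close>,
  where \<open>T\<close> is a norm-preserving extension of \<open>D p\<close> to the whole space. Hence property (*) applied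
  to an extension of \<open>f - T\<close> gives a local smooth approximation of \<open>f\<close> whose error is as small as
  we please, has a small Lipschitz constant on \<open>Y\<close>, and whose derivative is close to \<open>D\<close> there.
  The local approximations are glued by a smooth Lipschitz partition of unity. The Lipschitz
  constants and the separation of its pieces are known before the errors of the local
  approximations are chosen, so these errors can absorb them; this keeps the Lipschitz
  estimates global although \<open>Y\<close> need not be convex.
\<close>

section \<open>Norm-preserving extension of functionals\<close>

text \<open>In a nonseparable space a partition of unity may need uncountably many functions, and no
  summable family of positive errors can be assigned to these. The cover is therefore organised into
  countably many layers, each a union of pieces that are \<open>s n\<close> apart, in the spirit of
  Stone's proof that metric spaces are paracompact. The error then depends on the layer only:
  \<open>\<eta> n * (L n + 2 / s n)\<close> stays below a term of a geometric series, where
  \<open>L n\<close> pays for the change of a weight and \<open>2 / s n\<close> for a jump between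
  two pieces. Part (iii) has to hold for the same function as (i) and (ii). A proposition
  \<open>P\<close> switches on the Lipschitz data, so that the construction is done once; under
  \<open>P\<close> the local data decompose \<open>F\<close> on the whole space and not only
  \<open>f\<close> on \<open>Y\<close>. The constant C1 is \<open>35 * max C0 0 + 2\<close>. Here 35
  is 1 + 2 * 17, with 17 a bound for the slope of a truncation, and the 2 is due to \<open>F\<close>
  entering the final estimate twice.\<close>

lemma subspace_closure_normed:
  fixes S :: "'a::real_normed_vector set"
  assumes "subspace S"
  shows "subspace (closure S)"
  unfolding subspace_def
proof (intro conjI ballI allI)
  show "0 \<in> closure S"
    using assms closure_subset subspace_0 by blast
  fix x y assume "x \<in> closure S" "y \<in> closure S"
  then obtain a b where "\<And>n. a n \<in> S" "a \<longlonglongrightarrow> x" "\<And>n. b n \<in> S" "b \<longlonglongrightarrow> y"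
    unfolding closure_sequential by blast
  then have "\<And>n. a n + b n \<in> S" "(\<lambda>n. a n + b n) \<longlonglongrightarrow> x + y"
    using assms by (auto intro: subspace_add tendsto_add)
  then show "x + y \<in> closure S"
    unfolding closure_sequential by (intro exI[of _ "\<lambda>n. a n + b n"]) simp
next
  fix c :: real and x assume "x \<in> closure S"
  then obtain a where "\<And>n. a n \<in> S" "a \<longlonglongrightarrow> x"
    unfolding closure_sequential by blast
  then have "\<And>n. c *\<^sub>R a n \<in> S" "(\<lambda>n. c *\<^sub>R a n) \<longlonglongrightarrow> c *\<^sub>R x"
    using assms by (auto intro: subspace_scale tendsto_scaleR)
  then show "c *\<^sub>R x \<in> closure S"
    unfolding closure_sequential by (intro exI[of _ "\<lambda>n. c *\<^sub>R a n"]) simp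
qed

text \<open>Partial functionals are represented by their graphs, as subspaces of the product
  with the reals; the norm bound makes such a subspace single-valued.\<close>

lemma dominated_graph_extend:
  fixes M :: "('a::real_normed_vector \<times> real) set"
  assumes M: "subspace M" and dom: "\<And>x a. (x, a) \<in> M \<Longrightarrow> a \<le> B * norm x" and B: "0 \<le> B"
  obtains c M' where "subspace M'" "M \<subseteq> M'" "(x0, c) \<in> M'"
    "\<forall>x a. (x, a) \<in> M' \<longrightarrow> a \<le> B * norm x"
proof -
  define A where "A = {a - B * norm (x - x0) | x a. (x, a) \<in> M}"
  define c where "c = Sup A"
  have 0: "(0, 0) \<in> M" using subspace_0[OF M] by (simp add: zero_prod_def)
  \<comment> \<open>Every lower bound that a point of \<open>M\<close> puts on the new value lies
    below every upper bound, so the supremum of the lower bounds can be assigned to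
    \<open>x0\<close>.\<close>
  have sep: "a - B * norm (x - x0) \<le> B * norm (y + x0) - b" if "(x, a) \<in> M" "(y, b) \<in> M" for x a y b
  proof -
    have "a + b \<le> B * norm (x + y)"
      using dom subspace_add[OF M that] by simp
    also have "\<dots> \<le> B * (norm (x - x0) + norm (y + x0))"
      using norm_triangle_ineq[of "x - x0" "y + x0"] B by (intro mult_left_mono) auto
    finally show ?thesis by (simp add: algebra_simps)
  qed
  have ne: "A \<noteq> {}" using 0 unfolding A_def by blast
  have bdd: "bdd_above A"
    unfolding bdd_above_def A_def using sep[OF _ 0] by blast
  have lo: "a - B * norm (x - x0) \<le> c" if "(x, a) \<in> M" for x a
    unfolding c_def using that by (intro cSup_upper bdd) (auto simp: A_def)
  have up: "c \<le> B * norm (x + x0) - a" if "(x, a) \<in> M" for x a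
    unfolding c_def using that sep by (intro cSup_least ne) (auto simp: A_def)
  define M' where "M' = {(x + t *\<^sub>R x0, a + t * c) | x a t. (x, a) \<in> M}"
  show ?thesis
  proof
    show "subspace M'"
      unfolding subspace_def
    proof (intro conjI ballI allI)
      show "0 \<in> M'" using 0 unfolding M'_def zero_prod_def by force
    next
      fix p q assume "p \<in> M'" "q \<in> M'"
      then obtain x a t y b s where "(x, a) \<in> M" "(y, b) \<in> M"
        and "p = (x + t *\<^sub>R x0, a + t * c)" "q = (y + s *\<^sub>R x0, b + s * c)"
        unfolding M'_def by blast
      then have "(x + y, a + b) \<in> M" "p + q = ((x + y) + (t + s) *\<^sub>R x0, (a + b) + (t + s) * c)"
        using subspace_add[OF M, of "(x,a)" "(y,b)"] by (auto simp: algebra_simps)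
      then show "p + q \<in> M'" unfolding M'_def by blast
    next
      fix k p assume "p \<in> M'"
      then obtain x a t where "(x, a) \<in> M" and "p = (x + t *\<^sub>R x0, a + t * c)"
        unfolding M'_def by blast
      then have "(k *\<^sub>R x, k * a) \<in> M" "k *\<^sub>R p = (k *\<^sub>R x + (k * t) *\<^sub>R x0, k * a + (k * t) * c)"
        using subspace_scale[OF M, of "(x,a)" k] by (auto simp: algebra_simps)
      then show "k *\<^sub>R p \<in> M'" unfolding M'_def by blast
    qed
    show "M \<subseteq> M'"
    proof
      fix p assume "p \<in> M"
      then have "(fst p, snd p) \<in> M" "p = (fst p + 0 *\<^sub>R x0, snd p + 0 * c)" by auto
      then show "p \<in> M'" unfolding M'_def by blast
    qed
    show "(x0, c) \<in> M'"
      unfolding M'_def using 0 by (intro CollectI exI[of _ 0] exI[of _ 0] exI[of _ 1]) auto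
    show "\<forall>y b. (y, b) \<in> M' \<longrightarrow> b \<le> B * norm y"
    proof (intro allI impI)
      fix y b assume "(y, b) \<in> M'"
      then obtain x a t where xa: "(x, a) \<in> M" and y: "y = x + t *\<^sub>R x0" and b: "b = a + t * c"
        unfolding M'_def by blast
      have sc: "(k *\<^sub>R x, k * a) \<in> M" for k
        using subspace_scale[OF M xa, of k] by simp
      \<comment> \<open>Dividing by the absolute value of \<open>t\<close> reduces the claim to the
        coefficients 1 and -1, which \<open>up\<close> and \<open>lo\<close> settle.\<close>
      consider "t = 0" | "t > 0" | "t < 0" by linarith
      then show "b \<le> B * norm y"
      proof cases
        case 1 then show ?thesis using dom[OF xa] y b by simp
      next
        case 2
        have n: "norm (inverse t *\<^sub>R x + x0) = inverse t * norm y"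
        proof -
          have "inverse t *\<^sub>R x + x0 = inverse t *\<^sub>R y"
            using 2 by (simp add: y algebra_simps)
          then show ?thesis using 2 by simp
        qed
        have "t * c \<le> t * (B * (inverse t * norm y) - inverse t * a)"
          using up[OF sc[of "inverse t"]] 2 unfolding n by (intro mult_left_mono) auto
        also have "\<dots> = B * norm y - a" using 2 by (simp add: field_simps)
        finally show ?thesis by (simp add: b)
      next
        case 3
        have n: "norm (inverse (-t) *\<^sub>R x - x0) = inverse (-t) * norm y"
        proof -
          have "inverse (-t) *\<^sub>R x - x0 = inverse (-t) *\<^sub>R y"
            using 3 by (simp add: y algebra_simps)
          then show ?thesis using 3 by simp
        qed
        have "a - B * norm y = (-t) * (inverse (-t) * a - B * (inverse (-t) * norm y))"
          using 3 by (simp add: field_simps)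
        also have "\<dots> \<le> (-t) * c"
          using lo[OF sc[of "inverse (-t)"]] 3 unfolding n by (intro mult_left_mono) auto
        finally show ?thesis by (simp add: b)
      qed
    qed
  qed
qed

text \<open>A maximal graph dominated by \<open>B * norm\<close> has full domain, because otherwise
  one more point could be added. One-sided domination is enough, since applying it to
  \<open>- x\<close> bounds the absolute value.\<close>

theorem hahn_banach_normed:
  fixes Z :: "'a::real_normed_vector set" and \<phi> :: "'a \<Rightarrow> real"
  assumes Z: "subspace Z"
    and add: "\<And>u v. u \<in> Z \<Longrightarrow> v \<in> Z \<Longrightarrow> \<phi> (u + v) = \<phi> u + \<phi> v"
    and scale: "\<And>u c. u \<in> Z \<Longrightarrow> \<phi> (c *\<^sub>R u) = c * \<phi> u"
    and bound: "\<And>z. z \<in> Z \<Longrightarrow> \<bar>\<phi> z\<bar> \<le> B * norm z" and B: "0 \<le> B"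
  obtains T :: "'a \<Rightarrow>\<^sub>L real" where "\<forall>z\<in>Z. T z = \<phi> z" "norm T \<le> B"
proof -
  define G0 where "G0 = {(z, \<phi> z) | z. z \<in> Z}"
  define A where "A = {g. subspace g \<and> G0 \<subseteq> g \<and> (\<forall>x a. (x, a) \<in> g \<longrightarrow> a \<le> B * norm x)}"
  have "subspace G0"
    unfolding subspace_def
  proof (intro conjI ballI allI)
    show "0 \<in> G0"
      using subspace_0[OF Z] scale[of 0 0] unfolding G0_def zero_prod_def by force
    show "p + q \<in> G0" if "p \<in> G0" "q \<in> G0" for p q
      using that subspace_add[OF Z] add unfolding G0_def by force
    show "c *\<^sub>R p \<in> G0" if "p \<in> G0" for c p
      using that subspace_scale[OF Z] scale unfolding G0_def by force
  qed
  then have "G0 \<in> A"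
    using bound abs_le_D1 unfolding A_def G0_def by blast
  moreover have "\<Union>\<C> \<in> A" if ne: "\<C> \<noteq> {}" and ch: "subset.chain A \<C>" for \<C>
  proof -
    have sub: "\<C> \<subseteq> A" and tot: "\<And>g h. g \<in> \<C> \<Longrightarrow> h \<in> \<C> \<Longrightarrow> g \<subseteq> h \<or> h \<subseteq> g"
      using ch by (auto simp: subset_chain_def)
    have "subspace (\<Union>\<C>)"
      unfolding subspace_def
    proof (intro conjI ballI allI)
      show "0 \<in> \<Union>\<C>"
        using ne sub subspace_0 unfolding A_def by blast
      fix p q assume "p \<in> \<Union>\<C>" "q \<in> \<Union>\<C>"
      then obtain g where "g \<in> \<C>" "p \<in> g" "q \<in> g"
        using tot by blast
      then show "p + q \<in> \<Union>\<C>"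
        using sub subspace_add unfolding A_def by blast
    next
      fix c :: real and p assume "p \<in> \<Union>\<C>"
      then show "c *\<^sub>R p \<in> \<Union>\<C>"
        using sub subspace_scale unfolding A_def by blast
    qed
    then show ?thesis
      using sub ne unfolding A_def by blast
  qed
  ultimately obtain M where MA: "M \<in> A" and max: "\<And>g. g \<in> A \<Longrightarrow> M \<subseteq> g \<Longrightarrow> g = M"
    using subset_Zorn_nonempty[of A] by blast
  have M: "subspace M" and G0M: "G0 \<subseteq> M" and dom: "\<And>x a. (x, a) \<in> M \<Longrightarrow> a \<le> B * norm x"
    using MA unfolding A_def by auto
  have "\<exists>a. (x, a) \<in> M" for x
  proof -
    obtain c M' where "subspace M'" "M \<subseteq> M'" and x: "(x, c) \<in> M'"
      and "\<forall>x a. (x, a) \<in> M' \<longrightarrow> a \<le> B * norm x"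
      by (rule dominated_graph_extend[OF M dom B, of x])
    then have "M' \<in> A" using G0M unfolding A_def by auto
    then have "M' = M" using max \<open>M \<subseteq> M'\<close> by simp
    then show ?thesis using x by auto
  qed
  then obtain t where t: "\<And>x. (x, t x) \<in> M" by metis
  \<comment> \<open>Two values over one point would put \<open>(0, d)\<close> and
    \<open>(0, - d)\<close> into \<open>M\<close>, and domination at 0 forces
    \<open>d = 0\<close>.\<close>
  have uniq: "a = t x" if "(x, a) \<in> M" for x a
    using dom[of 0 "a - t x"] dom[of 0 "t x - a"]
      subspace_diff[OF M that t[of x]] subspace_diff[OF M t[of x] that] by auto
  have t_add: "t (x + y) = t x + t y" for x y
    using uniq[of "x + y" "t x + t y"] subspace_add[OF M t[of x] t[of y]] by simp
  have t_scale: "t (c *\<^sub>R x) = c * t x" for c x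
    using uniq[of "c *\<^sub>R x" "c * t x"] subspace_scale[OF M t[of x], of c] by simp
  have t_bound: "\<bar>t x\<bar> \<le> B * norm x" for x
    using dom[OF t[of x]] dom[OF t[of "- x"]] t_scale[of "-1" x] by auto
  have bl: "bounded_linear t"
    by (rule bounded_linear_intro[where K=B])
      (use t_add t_scale t_bound in \<open>auto simp: mult.commute\<close>)
  show ?thesis
  proof
    show "\<forall>z\<in>Z. Blinfun t z = \<phi> z"
    proof
      fix z assume "z \<in> Z"
      then have "(z, \<phi> z) \<in> M" using G0M unfolding G0_def by blast
      then show "Blinfun t z = \<phi> z" using uniq by (simp add: bounded_linear_Blinfun_apply[OF bl])
    qed
    show "norm (Blinfun t) \<le> B"
      by (rule norm_blinfun_bound[OF B])
        (use t_bound in \<open>simp add: bounded_linear_Blinfun_apply[OF bl]\<close>)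
  qed
qed

section \<open>Lipschitz constants and dual norms\<close>

text \<open>McShane's formula: the lower envelope of the cones of slope \<open>L\<close> with
  vertices on the graph. Property star speaks of functions on the whole space; this makes it
  applicable to data with a small constant on a subset.\<close>

lemma lipschitz_extension_mcshane:
  fixes f :: "'a::metric_space \<Rightarrow> real"
  assumes "L-lipschitz_on S f"
  obtains g where "L-lipschitz_on UNIV g" "\<forall>x\<in>S. g x = f x"
proof (cases "S = {}")
  case True
  have "L-lipschitz_on UNIV (\<lambda>x::'a. 0::real)"
    using lipschitz_on_nonneg[OF assms] by (auto intro: lipschitz_onI)
  then show ?thesis using that True by blast
next
  case False
  have L: "0 \<le> L" using lipschitz_on_nonneg[OF assms] .
  have f: "f s - f u \<le> L * dist s u" if "s \<in> S" "u \<in> S" for s u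
    using lipschitz_onD[OF assms that] by (simp add: dist_real_def)
  define g where "g x = (INF s\<in>S. f s + L * dist x s)" for x
  have tri: "L * dist u v \<le> L * dist u w + L * dist w v" for u v w
    using mult_left_mono[OF dist_triangle[of u v w] L] by (simp add: algebra_simps)
  have bdd: "bdd_below ((\<lambda>s. f s + L * dist x s) ` S)" for x
  proof -
    obtain u where u: "u \<in> S" using False by blast
    have "f u - L * dist u x \<le> f s + L * dist x s" if "s \<in> S" for s
      using f[OF u that] tri[of u s x] by linarith
    then show ?thesis unfolding bdd_below_def by blast
  qed
  have le: "g x \<le> g y + L * dist x y" for x y
  proof -
    have "g x - L * dist x y \<le> g y"
      unfolding g_def[of y]
    proof (rule cINF_greatest[OF False])
      fix s assume "s \<in> S"
      then have "g x \<le> f s + L * dist x s"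
        unfolding g_def by (intro cINF_lower bdd)
      then show "g x - L * dist x y \<le> f s + L * dist y s"
        using tri[of x s y] by linarith
    qed
    then show ?thesis by linarith
  qed
  have "L-lipschitz_on UNIV g"
  proof (rule lipschitz_onI[OF _ L])
    fix x y
    show "dist (g x) (g y) \<le> L * dist x y"
      using le[of x y] le[of y x] by (auto simp: dist_real_def dist_commute abs_le_iff)
  qed
  moreover have "g x = f x" if "x \<in> S" for x
  proof (rule antisym)
    show "g x \<le> f x"
      using cINF_lower[OF bdd that, of x] unfolding g_def by simp
    show "f x \<le> g x"
      unfolding g_def using f[OF that] by (intro cINF_greatest[OF False]) (simp add: algebra_simps)
  qed
  ultimately show ?thesis using that by blast
qed

text \<open>A real supremum is informative only for a nonempty bounded set. The inserted 0 secures
  the first, any Lipschitz constant the second, and \<open>lip S f\<close> is then the least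
  constant.\<close>

lemma
  assumes "L-lipschitz_on S f"
  shows lip_nonneg: "0 \<le> lip S f"
    and lip_le: "lip S f \<le> L"
    and lipschitz_on_lip: "(lip S f)-lipschitz_on S f"
proof -
  let ?Q = "insert 0 {dist (f x) (f y) / dist x y | x y. x \<in> S \<and> y \<in> S \<and> x \<noteq> y}"
  have ub: "q \<le> L" if "q \<in> ?Q" for q
    using that lipschitz_on_nonneg[OF assms] lipschitz_onD[OF assms]
    by (auto simp: divide_le_eq)
  then have bdd: "bdd_above ?Q" unfolding bdd_above_def by blast
  show "lip S f \<le> L"
    unfolding lip_def using ub by (intro cSup_least) auto
  show nn: "0 \<le> lip S f"
    unfolding lip_def by (intro cSup_upper bdd) auto
  show "(lip S f)-lipschitz_on S f"
  proof (rule lipschitz_onI[OF _ nn])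
    fix x y assume xy: "x \<in> S" "y \<in> S"
    show "dist (f x) (f y) \<le> lip S f * dist x y"
    proof (cases "x = y")
      case False
      have "dist (f x) (f y) / dist x y \<le> lip S f"
        unfolding lip_def using xy False by (intro cSup_upper bdd) auto
      then show ?thesis using False by (simp add: divide_le_eq)
    qed simp
  qed
qed

lemma lip_mono:
  assumes "L-lipschitz_on T f" "S \<subseteq> T"
  shows "lip S f \<le> lip T f"
  using lip_le[OF lipschitz_on_subset[OF lipschitz_on_lip[OF assms(1)] assms(2)]] .

lemma bdd_above_in_dual:
  assumes "in_dual Z \<phi>"
  shows "bdd_above (insert 0 {\<bar>\<phi> z\<bar> | z. z \<in> Z \<and> norm z \<le> 1})"
proof -
  obtain B where B: "\<And>z. z \<in> Z \<Longrightarrow> \<bar>\<phi> z\<bar> \<le> B * norm z"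
    using assms unfolding in_dual_def by blast
  show ?thesis
    unfolding bdd_above_def
  proof (intro exI[of _ "\<bar>B\<bar>"] ballI)
    fix q assume "q \<in> insert 0 {\<bar>\<phi> z\<bar> | z. z \<in> Z \<and> norm z \<le> 1}"
    then consider "q = 0" | u where "u \<in> Z" "norm u \<le> 1" "q = \<bar>\<phi> u\<bar>" by auto
    then show "q \<le> \<bar>B\<bar>"
    proof cases
      case 2
      have "q \<le> \<bar>B\<bar> * norm u"
        using B[OF 2(1)] 2(3) mult_right_mono[OF abs_ge_self norm_ge_zero, of B u] by simp
      also have "\<dots> \<le> \<bar>B\<bar>" using 2(2) by (simp add: mult_left_le)
      finally show ?thesis .
    qed simp
  qed
qed

lemma dual_norm_nonneg: "in_dual Z \<phi> \<Longrightarrow> 0 \<le> dual_norm Z \<phi>"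
  unfolding dual_norm_def by (intro cSup_upper bdd_above_in_dual) auto

lemma dual_norm_bound:
  assumes "subspace Z" "in_dual Z \<phi>" "z \<in> Z"
  shows "\<bar>\<phi> z\<bar> \<le> dual_norm Z \<phi> * norm z"
proof (cases "z = 0")
  case True
  have "\<phi> (0 *\<^sub>R z) = 0 * \<phi> z" using assms(2,3) unfolding in_dual_def by blast
  then show ?thesis using True by simp
next
  case False
  let ?w = "inverse (norm z) *\<^sub>R z"
  have w: "?w \<in> Z" "norm ?w \<le> 1"
    using assms False by (auto intro: subspace_scale)
  then have "\<bar>\<phi> ?w\<bar> \<le> dual_norm Z \<phi>"
    unfolding dual_norm_def by (intro cSup_upper bdd_above_in_dual assms(2)) blast
  then have "norm z * \<bar>\<phi> ?w\<bar> \<le> norm z * dual_norm Z \<phi>"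
    by (intro mult_left_mono) auto
  moreover have "norm z * \<bar>\<phi> ?w\<bar> = \<bar>\<phi> z\<bar>"
    using assms(2,3) False unfolding in_dual_def by (simp add: abs_mult)
  ultimately show ?thesis by (simp add: mult.commute)
qed

lemma dual_norm_le:
  assumes "0 \<le> B" "\<And>z. z \<in> Z \<Longrightarrow> \<bar>\<phi> z\<bar> \<le> B * norm z"
  shows "dual_norm Z \<phi> \<le> B"
  unfolding dual_norm_def
proof (rule cSup_least)
  fix q assume "q \<in> insert 0 {\<bar>\<phi> z\<bar> | z. z \<in> Z \<and> norm z \<le> 1}"
  then show "q \<le> B"
    using assms by (auto intro: order_trans[OF assms(2)] simp: mult_left_le)
qed simp

lemma in_dual_diff:
  assumes "in_dual Z \<phi>" "in_dual Z \<psi>"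
  shows "in_dual Z (\<lambda>z. \<phi> z - \<psi> z)"
proof -
  obtain B C where "\<And>z. z \<in> Z \<Longrightarrow> \<bar>\<phi> z\<bar> \<le> B * norm z" "\<And>z. z \<in> Z \<Longrightarrow> \<bar>\<psi> z\<bar> \<le> C * norm z"
    using assms unfolding in_dual_def by blast
  then have "\<bar>\<phi> z - \<psi> z\<bar> \<le> (B + C) * norm z" if "z \<in> Z" for z
    using that by (intro order_trans[OF abs_triangle_ineq4]) (simp add: distrib_right add_mono)
  then have "\<exists>B. \<forall>z\<in>Z. \<bar>\<phi> z - \<psi> z\<bar> \<le> B * norm z" by blast
  then show ?thesis
    using assms unfolding in_dual_def by (auto simp: algebra_simps)
qed

lemma subspace_Zsp: "subspace (Zsp Y)"
  unfolding Zsp_def by (intro subspace_closure_normed subspace_span)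

lemma diff_in_Zsp: "y \<in> Y \<Longrightarrow> y' \<in> Y \<Longrightarrow> y - y' \<in> Zsp Y"
  unfolding Zsp_def by (intro subsetD[OF closure_subset] span_base) blast

section \<open>Continuously differentiable functions\<close>

lemma C1_deriv_continuous:
  assumes "C1_deriv f f'"
  shows "continuous_on UNIV f"
  using assms unfolding C1_deriv_def
  by (meson continuous_at_imp_continuous_on has_derivative_continuous)

lemma C1_deriv_const: "C1_deriv (\<lambda>x. c) (\<lambda>x. 0)"
  unfolding C1_deriv_def by (auto simp: zero_blinfun.rep_eq)

lemma C1_deriv_blinfun: "C1_deriv (blinfun_apply T) (\<lambda>x. T)"
  unfolding C1_deriv_def
  by (auto intro: bounded_linear_imp_has_derivative blinfun.bounded_linear_right)

lemma C1_deriv_add: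
  assumes "C1_deriv f f'" "C1_deriv g g'"
  shows "C1_deriv (\<lambda>x. f x + g x) (\<lambda>x. f' x + g' x)"
  using assms unfolding C1_deriv_def
  by (auto intro!: derivative_eq_intros continuous_intros simp: blinfun.add_left fun_eq_iff)

lemma C1_deriv_diff:
  assumes "C1_deriv f f'" "C1_deriv g g'"
  shows "C1_deriv (\<lambda>x. f x - g x) (\<lambda>x. f' x - g' x)"
  using assms unfolding C1_deriv_def
  by (auto intro!: derivative_eq_intros continuous_intros simp: blinfun.diff_left fun_eq_iff)

lemma C1_deriv_mult:
  assumes "C1_deriv f f'" "C1_deriv g g'"
  shows "C1_deriv (\<lambda>x. f x * g x) (\<lambda>x. f x *\<^sub>R g' x + g x *\<^sub>R f' x)"
  using assms C1_deriv_continuous[OF assms(1)] C1_deriv_continuous[OF assms(2)]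
  unfolding C1_deriv_def
  by (auto intro!: derivative_eq_intros continuous_intros
      simp: blinfun.add_left blinfun.scaleR_left fun_eq_iff)

lemma C1_deriv_sum:
  assumes "\<And>i. i \<in> I \<Longrightarrow> C1_deriv (f i) (f' i)"
  shows "C1_deriv (\<lambda>x. \<Sum>i\<in>I. f i x) (\<lambda>x. \<Sum>i\<in>I. f' i x)"
  using assms
  by (induction I rule: infinite_finite_induct) (auto intro: C1_deriv_const C1_deriv_add)

lemma C1_deriv_compose:
  assumes "C1_deriv f f'" and h: "\<And>t. (h has_real_derivative h' t) (at t)" "continuous_on UNIV h'"
  shows "C1_deriv (\<lambda>x. h (f x)) (\<lambda>x. h' (f x) *\<^sub>R f' x)"
  unfolding C1_deriv_def
proof (intro conjI allI)
  fix x
  have "(f has_derivative f' x) (at x)" using assms(1) unfolding C1_deriv_def by blast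
  from DERIV_compose_FDERIV[OF h(1) this]
  show "((\<lambda>x. h (f x)) has_derivative blinfun_apply (h' (f x) *\<^sub>R f' x)) (at x)"
    by (simp add: scaleR_blinfun.rep_eq mult.commute[of "h' (f x)"])
next
  have "continuous_on UNIV (\<lambda>x. h' (f x))"
    using continuous_on_compose2[OF h(2) C1_deriv_continuous[OF assms(1)]] by simp
  then show "continuous_on UNIV (\<lambda>x. h' (f x) *\<^sub>R f' x)"
    using assms(1) unfolding C1_deriv_def by (auto intro: continuous_intros)
qed

lemma C1_deriv_unique_on_open:
  assumes "C1_deriv f f'" "C1_deriv g g'" "open U" "x \<in> U" "\<And>y. y \<in> U \<Longrightarrow> f y = g y"
  shows "f' x = g' x"
proof -
  have f: "(f has_derivative f' x) (at x)" and g: "(g has_derivative g' x) (at x)"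
    using assms unfolding C1_deriv_def by blast+
  have "(g has_derivative f' x) (at x)"
    using has_derivative_transform_within_open[OF f assms(3,4,5)] .
  then show ?thesis
    using has_derivative_unique[OF _ g] by (auto intro: blinfun_eqI)
qed

text \<open>At each point the derivative is taken from that point's own local representation. It is
  continuous at \<open>x\<close> because near \<open>x\<close> all representations share the
  derivative of the one chosen for \<open>x\<close>.\<close>

lemma C1_deriv_local:
  assumes "\<And>x. \<exists>U h h'. open U \<and> x \<in> U \<and> C1_deriv h h' \<and> (\<forall>y\<in>U. g y = h y)"
  obtains g' where "C1_deriv g g'"
proof -
  obtain U h h' where U: "\<And>x. open (U x)" "\<And>x. x \<in> U x" and h: "\<And>x. C1_deriv (h x) (h' x)"
    and eq: "\<And>x y. y \<in> U x \<Longrightarrow> g y = h x y"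
    using assms by metis
  have "C1_deriv g (\<lambda>x. h' x x)"
    unfolding C1_deriv_def
  proof (intro conjI allI)
    fix x
    have "(h x has_derivative h' x x) (at x)" using h unfolding C1_deriv_def by blast
    then show "(g has_derivative h' x x) (at x)"
      by (rule has_derivative_transform_within_open[OF _ U]) (use eq in simp)
  next
    have "isCont (\<lambda>y. h' y y) x" for x
    proof -
      have "h' y y = h' x y" if y: "y \<in> U x" for y
        using C1_deriv_unique_on_open[OF h[of y] h[of x], of "U x \<inter> U y" y] U eq y
        by (metis IntE IntI open_Int)
      moreover have "isCont (h' x) x"
        using h unfolding C1_deriv_def by (auto simp: continuous_on_eq_continuous_at)
      moreover have "\<forall>\<^sub>F y in nhds x. y \<in> U x"
        using U by (intro eventually_nhds_in_open)
      ultimately show ?thesis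
        by (subst isCont_cong[where g="h' x"]) (auto elim: eventually_mono)
    qed
    then show "continuous_on UNIV (\<lambda>x. h' x x)"
      by (simp add: continuous_on_eq_continuous_at)
  qed
  then show ?thesis using that by blast
qed

text \<open>Difference quotients along the line through \<open>x\<close> in direction
  \<open>v\<close> are at most \<open>L * norm v\<close>, hence so is their limit.\<close>

lemma C1_deriv_norm_le:
  assumes "C1_deriv f f'" "L-lipschitz_on UNIV f"
  shows "norm (f' x) \<le> L"
proof (rule norm_blinfun_bound)
  show "0 \<le> L" using lipschitz_on_nonneg[OF assms(2)] .
  fix v
  have "(f has_derivative f' x) (at x)" using assms unfolding C1_deriv_def by blast
  moreover have "((\<lambda>t. x + t *\<^sub>R v) has_derivative (\<lambda>t. t *\<^sub>R v)) (at 0)"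
    by (auto intro!: derivative_eq_intros)
  ultimately have "((\<lambda>t. f (x + t *\<^sub>R v)) has_derivative (\<lambda>t. f' x (t *\<^sub>R v))) (at 0)"
    using has_derivative_compose[of "\<lambda>t. x + t *\<^sub>R v" "\<lambda>t. t *\<^sub>R v" 0 UNIV f "f' x"] by simp
  then have "((\<lambda>t. f (x + t *\<^sub>R v)) has_real_derivative f' x v) (at 0)"
    by (simp add: has_field_derivative_def blinfun.scaleR_right mult_commute_abs)
  then have lim: "(\<lambda>t. norm ((f (x + t *\<^sub>R v) - f x) / t)) \<midarrow>0\<rightarrow> norm (f' x v)"
    unfolding DERIV_def by (intro tendsto_norm) simp
  show "norm (f' x v) \<le> L * norm v"
  proof (rule tendsto_upperbound[OF lim])
    show "\<forall>\<^sub>F t in at 0. norm ((f (x + t *\<^sub>R v) - f x) / t) \<le> L * norm v"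
      unfolding eventually_at_filter
    proof (intro always_eventually allI impI)
      fix t :: real assume "t \<noteq> 0"
      have "\<bar>f (x + t *\<^sub>R v) - f x\<bar> \<le> (L * norm v) * \<bar>t\<bar>"
        using lipschitz_onD[OF assms(2), of "x + t *\<^sub>R v" x]
        by (simp add: dist_norm mult.commute mult.left_commute)
      then show "norm ((f (x + t *\<^sub>R v) - f x) / t) \<le> L * norm v"
        using \<open>t \<noteq> 0\<close> by (simp add: pos_divide_le_eq)
    qed
  qed simp
qed

section \<open>A continuously differentiable cutoff and truncation on the real line\<close>

lemma has_real_derivative_pos_part_square:
  "((\<lambda>t. (max 0 t)\<^sup>2) has_real_derivative 2 * max 0 t) (at t)" for t :: real
proof -
  consider "t > 0" | "t < 0" | "t = 0" by linarith
  then show ?thesis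
  proof cases
    case 1
    have "((\<lambda>t. t\<^sup>2) has_real_derivative 2 * max 0 t) (at t)"
      using 1 by (auto intro!: derivative_eq_intros)
    then show ?thesis
      by (rule DERIV_cong_ev[THEN iffD1, rotated -1])
        (use 1 eventually_nhds_in_open[of "{0<..}" t] in \<open>auto elim!: eventually_mono\<close>)
  next
    case 2
    have "((\<lambda>t. 0) has_real_derivative 2 * max 0 t) (at t)"
      using 2 by (auto intro!: derivative_eq_intros)
    then show ?thesis
      by (rule DERIV_cong_ev[THEN iffD1, rotated -1])
        (use 2 eventually_nhds_in_open[of "{..<0}" t] in \<open>auto elim!: eventually_mono\<close>)
  next
    case 3
    \<comment> \<open>At the kink the difference quotient is 0 or \<open>h\<close> itself, so it
      tends to 0.\<close>
    have le: "\<forall>h::real. norm ((max 0 h)\<^sup>2 / h) \<le> norm h"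
      by (auto simp: power2_eq_square max_def)
    have "(\<lambda>h::real. (max 0 h)\<^sup>2 / h) \<midarrow>0\<rightarrow> 0"
      by (rule Lim_null_comparison[OF always_eventually[OF le] tendsto_norm_zero[OF tendsto_ident_at]])
    then show ?thesis unfolding 3 DERIV_def by simp
  qed
qed

text \<open>Two nested squared positive parts: the inner one leaves the value 1 at 0 with slope 0,
  the outer one reaches the value 0 at 1 with slope 0, so both joints are smooth.\<close>

definition cutoff :: "real \<Rightarrow> real" where
  "cutoff t = (max 0 (1 - (max 0 t)\<^sup>2))\<^sup>2"

definition cutoff' :: "real \<Rightarrow> real" where
  "cutoff' t = - 4 * max 0 (1 - (max 0 t)\<^sup>2) * max 0 t"

lemma cutoff_eq_1: "t \<le> 0 \<Longrightarrow> cutoff t = 1"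
  by (simp add: cutoff_def)

lemma cutoff_eq_0:
  assumes "1 \<le> t"
  shows "cutoff t = 0" "cutoff' t = 0"
proof -
  have "1 \<le> t\<^sup>2" using assms by simp
  with assms show "cutoff t = 0" "cutoff' t = 0"
    by (auto simp: cutoff_def cutoff'_def max.absorb2)
qed

lemma cutoff_range: "0 \<le> cutoff t" "cutoff t \<le> 1"
  by (auto simp: cutoff_def max_def power_le_one)

lemma has_real_derivative_cutoff: "(cutoff has_real_derivative cutoff' t) (at t)"
proof -
  have "((\<lambda>s. 1 - (max 0 s)\<^sup>2) has_real_derivative - (2 * max 0 t)) (at t)"
    using DERIV_diff[OF DERIV_const has_real_derivative_pos_part_square[of t], of 1] by simp
  from DERIV_chain2[OF has_real_derivative_pos_part_square this] show ?thesis
    unfolding cutoff_def[abs_def] cutoff'_def by (simp add: mult_ac)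
qed

lemma continuous_cutoff': "continuous_on UNIV cutoff'"
  unfolding cutoff'_def[abs_def] by (intro continuous_intros)

lemma abs_cutoff'_le: "\<bar>cutoff' t\<bar> \<le> 4"
proof (cases "0 < t \<and> t < 1")
  case True
  then have "\<bar>cutoff' t\<bar> = 4 * ((1 - t\<^sup>2) * t)"
    by (simp add: cutoff'_def abs_mult max_def power_le_one)
  also have "(1 - t\<^sup>2) * t \<le> 1 * 1"
    using True by (intro mult_mono) auto
  finally show ?thesis by simp
next
  case False
  then consider "t \<le> 0" | "1 \<le> t" by linarith
  then show ?thesis
    by cases (auto simp: cutoff_eq_0, simp add: cutoff'_def)
qed

lemma cutoff_lipschitz: "4-lipschitz_on UNIV cutoff"
proof (rule lipschitz_onI)
  fix x y :: real
  show "dist (cutoff x) (cutoff y) \<le> 4 * dist x y"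
    unfolding dist_norm
    by (rule field_differentiable_bound[where S=UNIV])
      (use has_real_derivative_cutoff abs_cutoff'_le in auto)
qed simp

text \<open>The identity between -1 and 1, switched off while \<open>t\<^sup>2\<close> runs from 1
  to 2: an arbitrary difference becomes bounded and small values are kept.\<close>

definition trunc :: "real \<Rightarrow> real" where
  "trunc t = t * cutoff (t\<^sup>2 - 1)"

definition trunc' :: "real \<Rightarrow> real" where
  "trunc' t = cutoff (t\<^sup>2 - 1) + t * (cutoff' (t\<^sup>2 - 1) * (2 * t))"

lemma trunc_eq: "\<bar>t\<bar> \<le> 1 \<Longrightarrow> trunc t = t"
  by (simp add: trunc_def cutoff_eq_1 abs_square_le_1)

lemma abs_trunc_le: "\<bar>trunc t\<bar> \<le> 2"
proof (cases "\<bar>t\<bar> \<le> 2")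
  case True
  have "\<bar>t\<bar> * \<bar>cutoff (t\<^sup>2 - 1)\<bar> \<le> 2 * 1"
    using True cutoff_range by (intro mult_mono) auto
  then show ?thesis by (simp add: trunc_def abs_mult)
next
  case False
  then have "2\<^sup>2 \<le> t\<^sup>2" by (metis abs_le_square_iff abs_numeral linear)
  then show ?thesis by (simp add: trunc_def cutoff_eq_0)
qed

lemma has_real_derivative_trunc: "(trunc has_real_derivative trunc' t) (at t)"
proof -
  have "((\<lambda>s. s\<^sup>2 - 1) has_real_derivative 2 * t) (at t)"
    by (auto intro!: derivative_eq_intros)
  from DERIV_mult[OF DERIV_ident DERIV_chain2[OF has_real_derivative_cutoff this]]
  show ?thesis
    unfolding trunc_def[abs_def] trunc'_def by (simp add: mult.commute)
qed

lemma continuous_trunc': "continuous_on UNIV trunc'"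
proof -
  have "continuous_on UNIV cutoff"
    using lipschitz_on_continuous_on[OF cutoff_lipschitz] .
  then show ?thesis
    unfolding trunc'_def[abs_def]
    by (intro continuous_on_add continuous_on_mult continuous_on_id continuous_on_const
        continuous_on_compose2[OF continuous_cutoff', of _ "\<lambda>t. t\<^sup>2 - 1"]
        continuous_on_compose2[of UNIV cutoff _ "\<lambda>t. t\<^sup>2 - 1"])
      (auto intro!: continuous_intros)
qed

text \<open>The cutoff contributes at most 1 and its derivative at most \<open>(2 * 2) * 4\<close>
  as long as \<open>t\<^sup>2 \<le> 2\<close>; beyond that both terms vanish.\<close>

lemma abs_trunc'_le: "\<bar>trunc' t\<bar> \<le> 17"
proof (cases "t\<^sup>2 \<le> 2")
  case True
  have "\<bar>t * (cutoff' (t\<^sup>2 - 1) * (2 * t))\<bar> = 2 * t\<^sup>2 * \<bar>cutoff' (t\<^sup>2 - 1)\<bar>"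
    by (simp add: abs_mult power2_eq_square)
  also have "\<dots> \<le> (2 * 2) * 4"
    using True abs_cutoff'_le by (intro mult_mono) auto
  finally show ?thesis
    using cutoff_range[of "t\<^sup>2 - 1"] unfolding trunc'_def by linarith
qed (simp add: trunc'_def cutoff_eq_0)

lemma trunc_lipschitz: "17-lipschitz_on UNIV trunc"
proof (rule lipschitz_onI)
  fix x y :: real
  show "dist (trunc x) (trunc y) \<le> 17 * dist x y"
    unfolding dist_norm
    by (rule field_differentiable_bound[where S=UNIV])
      (use has_real_derivative_trunc abs_trunc'_le in auto)
qed simp

section \<open>Approximation with control on a subset\<close>

lemma star_constD:
  fixes f :: "'a::real_normed_vector \<Rightarrow> real"
  assumes "star_const TYPE('a) C0" "L-lipschitz_on UNIV f" "e > 0"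
  obtains K K' where "C1_deriv K K'" "\<forall>x. \<bar>f x - K x\<bar> < e" "(C0 * lip UNIV f)-lipschitz_on UNIV K"
  using assms unfolding star_const_def C1_smooth_def by metis

text \<open>A negative constant is possible only when the space is trivial.\<close>

lemma star_const_mult_lip:
  fixes f :: "'a::real_normed_vector \<Rightarrow> real"
  assumes "star_const TYPE('a) C0" "L-lipschitz_on UNIV f"
  shows "max C0 0 * lip S f = C0 * lip S f"
proof (cases "C0 \<ge> 0")
  case False
  obtain K K' where "C1_deriv K K'" "\<forall>x. \<bar>f x - K x\<bar> < 1"
    and K: "(C0 * lip UNIV f)-lipschitz_on UNIV K"
    by (rule star_constD[OF assms zero_less_one])
  have "0 \<le> C0 * lip UNIV f" using lipschitz_on_nonneg[OF K] .
  then have "lip UNIV f \<le> 0" using False by (simp add: zero_le_mult_iff)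
  moreover have "0 \<le> lip S f" "lip S f \<le> lip UNIV f"
    using lip_nonneg[OF lipschitz_on_subset[OF assms(2)]] lip_mono[OF assms(2)] by auto
  ultimately show ?thesis by simp
qed simp

text \<open>Only the product \<open>C0 * lip UNIV f\<close> enters the definition, and it does not
  change; so the constant may be taken nonnegative.\<close>

lemma star_const_max:
  assumes "star_const TYPE('a::real_normed_vector) C0"
  shows "star_const TYPE('a) (max C0 0)"
  unfolding star_const_def using assms star_const_mult_lip[OF assms, of _ _ UNIV]
  unfolding star_const_def by (metis (no_types, lifting))

text \<open>The smooth approximation \<open>K1\<close> of a McShane extension of the restriction and the
  smooth approximation \<open>K2\<close> of the whole function differ by little near the given set, so
  adding a truncation of \<open>K1 - K2\<close> to \<open>K2\<close> yields exactly \<open>K1\<close> there.\<close>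

lemma C1_prop_of_star_const_nonneg:
  fixes C0 :: real
  assumes star: "star_const TYPE('a::real_normed_vector) C0" and C0: "0 \<le> C0"
  shows "C1_prop TYPE('a) C0 (35 * C0)"
  unfolding C1_prop_def
proof (intro allI impI)
  fix Y :: "'a set" and F :: "'a \<Rightarrow> real" and L e :: real
  assume "L-lipschitz_on UNIV F \<and> e > 0"
  then have F: "L-lipschitz_on UNIV F" and e: "e > 0" by auto
  define l where "l = lip Y F"
  \<comment> \<open>\<open>F - K2\<close> stays below \<open>s / 2\<close> and the truncated
    correction is at most \<open>2 * s\<close>; together this is \<open>e\<close>.\<close>
  define s where "s = 2 * e / 5"
  have s: "s > 0" using e by (simp add: s_def)
  have FY: "l-lipschitz_on Y F"
    unfolding l_def by (rule lipschitz_on_lip[OF lipschitz_on_subset[OF F]]) simp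
  have l0: "0 \<le> l" and lL: "l \<le> lip UNIV F"
    using lipschitz_on_nonneg[OF FY] lip_mono[OF F, of Y] unfolding l_def by auto
  \<comment> \<open>Extending the restriction turns the constant on \<open>Y\<close> into a global
    one, which the smoothing \<open>K1\<close> inherits up to the factor \<open>C0\<close>.\<close>
  obtain H where H: "l-lipschitz_on UNIV H" and HF: "\<forall>x\<in>Y. H x = F x"
    by (rule lipschitz_extension_mcshane[OF FY])
  obtain K1 K1' where K1: "C1_deriv K1 K1'" and HK1: "\<forall>x. \<bar>H x - K1 x\<bar> < s / 2"
    and LK1: "(C0 * lip UNIV H)-lipschitz_on UNIV K1"
    by (rule star_constD[OF star H, of "s/2"]) (use s in simp)
  obtain K2 K2' where K2: "C1_deriv K2 K2'" and FK2: "\<forall>x. \<bar>F x - K2 x\<bar> < s / 2"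
    and LK2: "(C0 * lip UNIV F)-lipschitz_on UNIV K2"
    by (rule star_constD[OF star F, of "s/2"]) (use s in simp)
  have LK1: "(C0 * l)-lipschitz_on UNIV K1"
    by (rule lipschitz_on_mono[OF LK1]) (auto intro: mult_left_mono C0 lip_le[OF H])
  \<comment> \<open>Rescaling by \<open>s\<close> stretches the range where \<open>trunc\<close> is
    the identity to differences up to \<open>s\<close>, and keeps the Lipschitz constant 17 whatever
    \<open>e\<close> is.\<close>
  define h where "h x = s * trunc (inverse s * (K1 x - K2 x))" for x
  define G where "G x = K2 x + h x" for x
  have "C1_deriv (\<lambda>x. inverse s * (K1 x - K2 x))
      (\<lambda>x. inverse s *\<^sub>R (K1' x - K2' x) + (K1 x - K2 x) *\<^sub>R 0)"
    by (intro C1_deriv_mult C1_deriv_const C1_deriv_diff K1 K2)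
  from C1_deriv_mult[OF C1_deriv_const[of s]
      C1_deriv_compose[OF this has_real_derivative_trunc continuous_trunc']]
  obtain G' where G': "C1_deriv G G'"
    unfolding G_def[abs_def] h_def using C1_deriv_add[OF K2] by blast
  \<comment> \<open>\<open>G\<close> and \<open>K1\<close> have to agree on an open set around
    \<open>Y\<close>, so that their derivatives agree on \<open>Y\<close> too.\<close>
  define V where "V = {x. \<bar>K1 x - K2 x\<bar> < s}"
  have GK1: "G x = K1 x" if "x \<in> V" for x
  proof -
    have "\<bar>inverse s * (K1 x - K2 x)\<bar> \<le> 1"
      using that s by (simp add: V_def abs_mult divide_simps)
    then show ?thesis using s by (simp add: G_def h_def trunc_eq mult.assoc[symmetric])
  qed
  have "open V"
    unfolding V_def using C1_deriv_continuous[OF K1] C1_deriv_continuous[OF K2]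
    by (intro open_Collect_less continuous_intros)
  have YV: "Y \<subseteq> V"
  proof
    fix x assume "x \<in> Y"
    then have "H x = F x" using HF by blast
    then have "\<bar>K1 x - K2 x\<bar> < s"
      using HK1[rule_format, of x] FK2[rule_format, of x] by linarith
    then show "x \<in> V" unfolding V_def by blast
  qed
  have "\<bar>F x - G x\<bar> \<le> e" for x
  proof -
    have "\<bar>h x\<bar> \<le> s * 2"
      unfolding h_def abs_mult using abs_trunc_le s by (intro mult_mono) auto
    then show ?thesis
      using FK2[rule_format, of x] s unfolding G_def s_def by linarith
  qed
  moreover have "(C0 * l)-lipschitz_on Y G"
  proof -
    have "(C0 * l)-lipschitz_on Y K1"
      by (rule lipschitz_on_subset[OF LK1]) simp
    then show ?thesis
      using YV GK1 by (simp add: lipschitz_on_def subset_iff)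
  qed
  moreover have "norm (G' y) \<le> C0 * l" if "y \<in> Y" for y
  proof -
    have "G' y = K1' y"
      using C1_deriv_unique_on_open[OF G' K1 \<open>open V\<close>] that YV GK1 by blast
    then show ?thesis using C1_deriv_norm_le[OF K1 LK1] by simp
  qed
  moreover have "(35 * C0 * lip UNIV F)-lipschitz_on UNIV G"
  proof (rule lipschitz_onI)
    fix x y :: 'a
    define d where "d = C0 * lip UNIV F * dist x y"
    have K1xy: "\<bar>K1 x - K1 y\<bar> \<le> d"
    proof -
      have "\<bar>K1 x - K1 y\<bar> \<le> C0 * l * dist x y"
        using lipschitz_onD[OF LK1, of x y] by (simp add: dist_real_def)
      also have "\<dots> \<le> d"
        unfolding d_def using C0 lL by (intro mult_right_mono mult_left_mono) auto
      finally show ?thesis .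
    qed
    have K2xy: "\<bar>K2 x - K2 y\<bar> \<le> d"
      using lipschitz_onD[OF LK2, of x y] by (simp add: dist_real_def d_def)
    have "\<bar>h x - h y\<bar> = s * dist (trunc (inverse s * (K1 x - K2 x))) (trunc (inverse s * (K1 y - K2 y)))"
      using s by (simp add: h_def dist_real_def right_diff_distrib[symmetric] abs_mult)
    also have "\<dots> \<le> s * (17 * dist (inverse s * (K1 x - K2 x)) (inverse s * (K1 y - K2 y)))"
      using s by (intro mult_left_mono lipschitz_onD[OF trunc_lipschitz]) auto
    also have "\<dots> = 17 * \<bar>(K1 x - K2 x) - (K1 y - K2 y)\<bar>"
      using s by (simp add: dist_real_def right_diff_distrib[symmetric] abs_mult)
    also have "\<dots> \<le> 17 * (2 * d)"
      using K1xy K2xy by (intro mult_left_mono) (auto simp: abs_le_iff)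
    \<comment> \<open>One \<open>d\<close> for \<open>K2\<close> and \<open>17 * (2 * d)\<close> for
      the correction make up 35.\<close>
    finally have "\<bar>G x - G y\<bar> \<le> 35 * d"
      using K2xy unfolding G_def abs_le_iff by auto
    then show "dist (G x) (G y) \<le> 35 * C0 * lip UNIV F * dist x y"
      by (simp add: dist_real_def d_def mult_ac)
  next
    show "0 \<le> 35 * C0 * lip UNIV F"
      using C0 lip_nonneg[OF F] by simp
  qed
  ultimately show "\<exists>G' DG'. C1_deriv G' DG' \<and> (\<forall>x. \<bar>F x - G' x\<bar> \<le> e) \<and>
      (C0 * lip Y F)-lipschitz_on Y G' \<and> (\<forall>y\<in>Y. norm (DG' y) \<le> C0 * lip Y F) \<and>
      (35 * C0 * lip UNIV F)-lipschitz_on UNIV G'"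
    using G' unfolding l_def by blast
qed

lemma C1_prop_mono:
  assumes "C1_prop TYPE('a::real_normed_vector) C0 c" "c \<le> c'"
  shows "C1_prop TYPE('a) C0 c'"
  unfolding C1_prop_def
proof (intro allI impI)
  fix Y :: "'a set" and F :: "'a \<Rightarrow> real" and L e :: real
  assume F: "L-lipschitz_on UNIV F \<and> e > 0"
  then have "c * lip UNIV F \<le> c' * lip UNIV F"
    using assms(2) lip_nonneg by (intro mult_right_mono) auto
  then show "\<exists>G' DG'. C1_deriv G' DG' \<and> (\<forall>x. \<bar>F x - G' x\<bar> \<le> e) \<and>
      (C0 * lip Y F)-lipschitz_on Y G' \<and> (\<forall>y\<in>Y. norm (DG' y) \<le> C0 * lip Y F) \<and>
      (c' * lip UNIV F)-lipschitz_on UNIV G'"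
    using assms(1) F unfolding C1_prop_def by (meson lipschitz_on_mono subset_refl)
qed

lemma C1_prop_of_star_const:
  assumes "star_const TYPE('a::real_normed_vector) C0"
  shows "C1_prop TYPE('a) C0 (35 * max C0 0)"
proof -
  have "C1_prop TYPE('a) (max C0 0) (35 * max C0 0)"
    by (intro C1_prop_of_star_const_nonneg star_const_max assms) simp
  then show ?thesis
    unfolding C1_prop_def by (metis (no_types, lifting) star_const_mult_lip[OF assms])
qed

section \<open>Smooth partitions of unity\<close>

text \<open>\<open>m x\<close> is the least index, in a well-ordering, of a member containing
  \<open>x\<close>. If \<open>m x\<close> comes before \<open>m y\<close>, minimality of
  \<open>m y\<close> keeps \<open>y\<close> out of \<open>U (m x)\<close>.\<close>

lemma least_index_choice:
  fixes U :: "'i \<Rightarrow> 'a set"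
  assumes "(\<Union>i. U i) = UNIV"
  obtains m where "\<forall>x. x \<in> U (m x)" "\<forall>x y. m x \<noteq> m y \<longrightarrow> y \<notin> U (m x) \<or> x \<notin> U (m y)"
proof -
  obtain r :: "'i rel" where r: "Well_order r" and F: "Field r = UNIV"
    using well_ordering[where 'a = 'i] by auto
  have wf: "wf (r - Id)" using r unfolding well_order_on_def by blast
  have tot: "(i, j) \<in> r \<or> (j, i) \<in> r" if "i \<noteq> j" for i j
    using r F that unfolding well_order_on_def linear_order_on_def total_on_def by simp
  have "\<exists>i. x \<in> U i \<and> (\<forall>j. (j, i) \<in> r - Id \<longrightarrow> x \<notin> U j)" for x
  proof -
    obtain i where "x \<in> U i" using assms by blast
    then have "\<exists>i\<in>{i. x \<in> U i}. \<forall>j. (j, i) \<in> r - Id \<longrightarrow> j \<notin> {i. x \<in> U i}"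
      using wf[unfolded wf_eq_minimal, rule_format, of i "{i. x \<in> U i}"] by simp
    then show ?thesis by simp
  qed
  then obtain m where m: "\<And>x. x \<in> U (m x)" "\<And>x j. (j, m x) \<in> r - Id \<Longrightarrow> x \<notin> U j"
    by metis
  have "y \<notin> U (m x) \<or> x \<notin> U (m y)" if "m x \<noteq> m y" for x y
    using m(2)[of "m x" y] m(2)[of "m y" x] tot[OF that] that by auto
  then show ?thesis using that m(1) by blast
qed

text \<open>The distance to \<open>V\<close> is 1-Lipschitz, so property star smooths it; the bump
  is a cutoff of the smoothed distance.\<close>

lemma C1_bump:
  fixes V :: "'a::real_normed_vector set"
  assumes star: "star_const TYPE('a) C0" and s: "s > 0"
  obtains \<Phi> \<Phi>' L where "C1_deriv \<Phi> \<Phi>'" "L-lipschitz_on UNIV \<Phi>"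
    "\<forall>x. 0 \<le> \<Phi> x \<and> \<Phi> x \<le> 1" "\<forall>x. \<Phi> x \<noteq> 0 \<longrightarrow> (\<exists>v\<in>V. dist x v < s)"
    "\<forall>v\<in>V. \<exists>W. open W \<and> v \<in> W \<and> (\<forall>y\<in>W. \<Phi> y = 1)"
proof (cases "V = {}")
  case True
  \<comment> \<open>\<open>infdist\<close> to the empty set is 0, so the general construction would
    give the constant 1; the zero function is taken instead.\<close>
  show ?thesis
    by (rule that[OF C1_deriv_const[of 0] lipschitz_on_constant]) (use True in auto)
next
  case False
  have "1-lipschitz_on UNIV (\<lambda>x. infdist x V)"
    by (rule lipschitz_onI) (auto simp: dist_real_def infdist_triangle_abs)
  then obtain K K' where K: "C1_deriv K K'" and close: "\<forall>x. \<bar>infdist x V - K x\<bar> < s / 8"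
    and LK: "(C0 * lip UNIV (\<lambda>x. infdist x V))-lipschitz_on UNIV K"
    by (rule star_constD[OF star _, of _ _ "s / 8"]) (use s in simp)
  \<comment> \<open>The cutoff falls from 1 to 0 while \<open>K\<close> runs from
    \<open>s / 4\<close> to \<open>3 * s / 4\<close>, which leaves room at both ends for the
    smoothing error \<open>s / 8\<close>.\<close>
  define h where "h x = (2 / s) * K x - 1 / 2" for x
  define \<Phi> where "\<Phi> x = cutoff (h x)" for x
  have "\<exists>h'. C1_deriv h h'"
    unfolding h_def[abs_def] using C1_deriv_diff[OF C1_deriv_mult[OF C1_deriv_const K] C1_deriv_const]
    by blast
  then obtain h' where h': "C1_deriv h h'" by blast
  have "\<exists>M. M-lipschitz_on UNIV h"
    unfolding h_def[abs_def]
    using lipschitz_on_diff[OF lipschitz_on_cmult_real[OF LK] lipschitz_on_constant] by blast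
  then obtain M where "M-lipschitz_on UNIV h" by blast
  then have L: "(4 * M)-lipschitz_on UNIV \<Phi>"
    unfolding \<Phi>_def[abs_def]
    by (rule lipschitz_on_compose2) (rule lipschitz_on_subset[OF cutoff_lipschitz], simp)
  have supp: "\<exists>v\<in>V. dist x v < s" if "\<Phi> x \<noteq> 0" for x
  proof -
    have "h x < 1" using that cutoff_eq_0(1)[of "h x"] unfolding \<Phi>_def by linarith
    then have "K x < 3 * s / 4" using s by (simp add: h_def field_simps)
    then have "infdist x V < s"
      using close[rule_format, of x] s by linarith
    then have "(INF a\<in>V. dist x a) < s" using False by (simp add: infdist_notempty)
    then show ?thesis using False by (subst (asm) cINF_less_iff) auto
  qed
  have one: "\<exists>W. open W \<and> v \<in> W \<and> (\<forall>y\<in>W. \<Phi> y = 1)" if "v \<in> V" for v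
  proof (intro exI conjI ballI)
    show "open {y. K y < s / 4}"
      using C1_deriv_continuous[OF K] by (intro open_Collect_less continuous_intros)
    show "v \<in> {y. K y < s / 4}"
      using close[rule_format, of v] that s by auto
    show "\<Phi> y = 1" if "y \<in> {y. K y < s / 4}" for y
      using that s unfolding \<Phi>_def h_def by (intro cutoff_eq_1) (simp add: field_simps)
  qed
  show ?thesis
  proof (rule that[OF _ L])
    show "C1_deriv \<Phi> (\<lambda>x. cutoff' (h x) *\<^sub>R h' x)"
      unfolding \<Phi>_def[abs_def]
      by (rule C1_deriv_compose[OF h' has_real_derivative_cutoff continuous_cutoff'])
    show "\<forall>x. 0 \<le> \<Phi> x \<and> \<Phi> x \<le> 1" unfolding \<Phi>_def using cutoff_range by blast
    show "\<forall>x. \<Phi> x \<noteq> 0 \<longrightarrow> (\<exists>v\<in>V. dist x v < s)" using supp by blast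
    show "\<forall>v\<in>V. \<exists>W. open W \<and> v \<in> W \<and> (\<forall>y\<in>W. \<Phi> y = 1)" using one by blast
  qed
qed

lemma lipschitz_on_mult_bounded:
  fixes f g :: "'a::metric_space \<Rightarrow> real"
  assumes "L-lipschitz_on S f" "M-lipschitz_on S g"
    and "\<And>x. x \<in> S \<Longrightarrow> \<bar>f x\<bar> \<le> 1" "\<And>x. x \<in> S \<Longrightarrow> \<bar>g x\<bar> \<le> 1"
  shows "(L + M)-lipschitz_on S (\<lambda>x. f x * g x)"
proof (rule lipschitz_onI)
  show "0 \<le> L + M" using lipschitz_on_nonneg[OF assms(1)] lipschitz_on_nonneg[OF assms(2)] by simp
  fix x y assume xy: "x \<in> S" "y \<in> S"
  have "\<bar>f x * g x - f y * g y\<bar> = \<bar>(f x - f y) * g x + f y * (g x - g y)\<bar>"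
    by (simp add: algebra_simps)
  also have "\<dots> \<le> \<bar>f x - f y\<bar> * \<bar>g x\<bar> + \<bar>f y\<bar> * \<bar>g x - g y\<bar>"
    by (metis abs_mult abs_triangle_ineq)
  also have "\<dots> \<le> \<bar>f x - f y\<bar> * 1 + 1 * \<bar>g x - g y\<bar>"
    using assms(3,4) xy by (intro add_mono mult_mono) auto
  also have "\<dots> \<le> L * dist x y + M * dist x y"
    using lipschitz_onD[OF assms(1) xy] lipschitz_onD[OF assms(2) xy] by (simp add: dist_real_def)
  finally show "dist (f x * g x) (f y * g y) \<le> (L + M) * dist x y"
    by (simp add: dist_real_def distrib_right)
qed

text \<open>A countable smooth partition of unity \<open>\<psi>\<close> such that the support of each \<open>\<psi> n\<close> splits
  into uniformly separated pieces, each of them inside one member of the cover \<open>U\<close>;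
  \<open>\<rho> n x\<close> is the index of the member that contains the piece around \<open>x\<close>.\<close>

locale sigma_discrete_partition =
  fixes U :: "'i \<Rightarrow> 'a::real_normed_vector set"
    and \<psi> :: "nat \<Rightarrow> 'a \<Rightarrow> real" and \<psi>' :: "nat \<Rightarrow> 'a \<Rightarrow> 'a \<Rightarrow>\<^sub>L real"
    and \<rho> :: "nat \<Rightarrow> 'a \<Rightarrow> 'i" and L s :: "nat \<Rightarrow> real"
  assumes C1_psi: "C1_deriv (\<psi> n) (\<psi>' n)"
    and lipschitz_psi: "(L n)-lipschitz_on UNIV (\<psi> n)"
    and psi_nonneg: "0 \<le> \<psi> n x"
    and locally_finite_sum: "\<exists>W N. open W \<and> x \<in> W \<and> (\<forall>y\<in>W. (\<forall>n\<ge>N. \<psi> n y = 0) \<and> (\<Sum>n<N. \<psi> n y) = 1)"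
    and supp_psi: "\<psi> n x \<noteq> 0 \<Longrightarrow> x \<in> U (\<rho> n x)"
    and s_pos: "0 < s n"
    and rho_eq: "\<psi> n x \<noteq> 0 \<Longrightarrow> \<psi> n y \<noteq> 0 \<Longrightarrow> dist x y < s n \<Longrightarrow> \<rho> n x = \<rho> n y"

text \<open>The sets of points whose \<open>3 s\<close>-ball lies in the first member of the cover that
  contains them (with respect to a well-ordering of the indices) are separated for distinct first
  members. Bumps \<open>\<Phi> n\<close> around them for \<open>s = 2^-n\<close> give the telescoping partition
  \<open>\<psi> n = \<Phi> n * (\<Prod>k<n. 1 - \<Phi> k)\<close>.\<close>

theorem sigma_discrete_partition_exists:
  fixes U :: "'i \<Rightarrow> 'a::real_normed_vector set"
  assumes star: "star_const TYPE('a) C0" and opn: "\<And>i. open (U i)" and cover: "(\<Union>i. U i) = UNIV"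
  obtains \<psi> \<psi>' \<rho> L s where "sigma_discrete_partition U \<psi> \<psi>' \<rho> L s"
proof -
  obtain m where m: "\<And>x. x \<in> U (m x)"
    and m_sep: "\<And>x y. m x \<noteq> m y \<Longrightarrow> y \<notin> U (m x) \<or> x \<notin> U (m y)"
    using least_index_choice[OF cover] by metis
  define s where "s n = (1 / 2 :: real) ^ n" for n
  have s: "s n > 0" for n by (simp add: s_def)
  \<comment> \<open>The factor 3: if two points of one layer are closer than \<open>s n\<close>,
    their centres are less than \<open>s n + s n + s n\<close> apart and lie in each other's
    ball.\<close>
  define V where "V n = {x. ball x (3 * s n) \<subseteq> U (m x)}" for n
  have "\<exists>\<Phi> \<Phi>' L. C1_deriv \<Phi> \<Phi>' \<and> L-lipschitz_on UNIV \<Phi> \<and> (\<forall>x. 0 \<le> \<Phi> x \<and> \<Phi> x \<le> 1)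
      \<and> (\<forall>x. \<Phi> x \<noteq> 0 \<longrightarrow> (\<exists>v\<in>V n. dist x v < s n))
      \<and> (\<forall>v\<in>V n. \<exists>W. open W \<and> v \<in> W \<and> (\<forall>y\<in>W. \<Phi> y = 1))" for n
    by (rule C1_bump[OF star s[of n], of "V n"]) blast
  then obtain \<Phi> \<Phi>' M where \<Phi>: "\<And>n. C1_deriv (\<Phi> n) (\<Phi>' n)" "\<And>n. (M n)-lipschitz_on UNIV (\<Phi> n)"
      "\<And>n x. 0 \<le> \<Phi> n x" "\<And>n x. \<Phi> n x \<le> 1"
    and supp: "\<And>n x. \<Phi> n x \<noteq> 0 \<Longrightarrow> \<exists>v\<in>V n. dist x v < s n"
    and one: "\<And>n v. v \<in> V n \<Longrightarrow> \<exists>W. open W \<and> v \<in> W \<and> (\<forall>y\<in>W. \<Phi> n y = 1)"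
    by metis
  define v where "v n x = (SOME v. v \<in> V n \<and> dist x v < s n)" for n x
  have v: "v n x \<in> V n" "dist x (v n x) < s n" if "\<Phi> n x \<noteq> 0" for n x
    using someI_ex[of "\<lambda>v. v \<in> V n \<and> dist x v < s n"] supp[OF that] unfolding v_def by blast+
  \<comment> \<open>The mass left over by the first \<open>n\<close> bumps; its decrements are the
    weights.\<close>
  define P where "P n x = (\<Prod>k<n. 1 - \<Phi> k x)" for n x
  have P01: "0 \<le> P n x" "P n x \<le> 1" for n x
    unfolding P_def using \<Phi>(3,4) by (auto intro!: prod_nonneg prod_le_1)
  have "(\<exists>P'. C1_deriv (P n) P') \<and> (\<exists>L. L-lipschitz_on UNIV (P n))" for n
  proof (induction n)
    case 0
    have "P 0 = (\<lambda>x. 1)" by (auto simp: P_def)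
    then show ?case using C1_deriv_const[of 1] lipschitz_on_constant[of UNIV 1] by metis
  next
    case (Suc n)
    then obtain P' L where P': "C1_deriv (P n) P'" and L: "L-lipschitz_on UNIV (P n)" by blast
    have P: "P (Suc n) = (\<lambda>x. P n x * (1 - \<Phi> n x))" by (simp add: P_def fun_eq_iff)
    have "(0 + M n)-lipschitz_on UNIV (\<lambda>x. 1 - \<Phi> n x)"
      by (intro lipschitz_on_diff lipschitz_on_constant \<Phi>(2))
    from lipschitz_on_mult_bounded[OF L this]
    have "(L + (0 + M n))-lipschitz_on UNIV (P (Suc n))"
      unfolding P using P01 \<Phi>(3,4) by (simp add: abs_le_iff)
    then show ?case
      unfolding P using C1_deriv_mult[OF P' C1_deriv_diff[OF C1_deriv_const \<Phi>(1)]] by blast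
  qed
  then obtain P' L where P': "\<And>n. C1_deriv (P n) (P' n)" and L: "\<And>n. (L n)-lipschitz_on UNIV (P n)"
    by metis
  define \<psi> where "\<psi> n x = P n x - P (Suc n) x" for n x
  have \<psi>: "\<psi> n x = \<Phi> n x * P n x" for n x
    by (simp add: \<psi>_def P_def algebra_simps)
  have sum_\<psi>: "(\<Sum>n<N. \<psi> n x) = 1 - P N x" for N x
    unfolding \<psi>_def by (subst sum_lessThan_telescope') (simp add: P_def)
  have "sigma_discrete_partition U \<psi> (\<lambda>n x. P' n x - P' (Suc n) x) (\<lambda>n x. m (v n x))
    (\<lambda>n. L n + L (Suc n)) s"
  proof
    fix n x y
    show "C1_deriv (\<psi> n) (\<lambda>x. P' n x - P' (Suc n) x)"
      unfolding \<psi>_def[abs_def] by (intro C1_deriv_diff P')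
    show "(L n + L (Suc n))-lipschitz_on UNIV (\<psi> n)"
      unfolding \<psi>_def[abs_def] by (intro lipschitz_on_diff L)
    show "0 \<le> \<psi> n x" unfolding \<psi> using \<Phi>(3) P01 by simp
    show "0 < s n" by (rule s)
    show "x \<in> U (m (v n x))" if "\<psi> n x \<noteq> 0"
    proof -
      have "\<Phi> n x \<noteq> 0" using that unfolding \<psi> by auto
      from v[OF this] s[of n] have "x \<in> ball (v n x) (3 * s n)" "v n x \<in> V n"
        by (auto simp: dist_commute)
      then show ?thesis unfolding V_def by blast
    qed
    show "m (v n x) = m (v n y)" if "\<psi> n x \<noteq> 0" "\<psi> n y \<noteq> 0" "dist x y < s n"
    proof (rule ccontr)
      assume ne: "m (v n x) \<noteq> m (v n y)"
      have "\<Phi> n x \<noteq> 0" "\<Phi> n y \<noteq> 0" using that unfolding \<psi> by auto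
      note vx = v[OF this(1)] and vy = v[OF this(2)]
      have "dist (v n x) (v n y) < 3 * s n"
        using vx(2) vy(2) that(3) dist_triangle[of "v n x" "v n y" x] dist_triangle[of x "v n y" y]
        by (simp add: dist_commute)
      then have "v n y \<in> U (m (v n x))" "v n x \<in> U (m (v n y))"
        using vx(1) vy(1) unfolding V_def by (auto simp: subset_iff dist_commute)
      then show False using m_sep[OF ne] by blast
    qed
    show "\<exists>W N. open W \<and> x \<in> W \<and> (\<forall>y\<in>W. (\<forall>n\<ge>N. \<psi> n y = 0) \<and> (\<Sum>n<N. \<psi> n y) = 1)"
    proof -
      obtain e where e: "e > 0" "ball x e \<subseteq> U (m x)"
        using opn m open_contains_ball by metis
      obtain k where "(1 / 2 :: real) ^ k < e / 3"
        using real_arch_pow_inv[of "e / 3" "1 / 2"] e by auto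
      then have "ball x (3 * s k) \<subseteq> ball x e" by (intro subset_ball) (simp add: s_def)
      then have "x \<in> V k" using e unfolding V_def by blast
      from one[OF this] obtain W where W: "open W" "x \<in> W" "\<And>y. y \<in> W \<Longrightarrow> \<Phi> k y = 1" by blast
      \<comment> \<open>\<open>Suc k\<close>, because \<open>P n\<close> contains the factor for
        \<open>k\<close> only when \<open>k < n\<close>.\<close>
      have "P n y = 0" if "y \<in> W" "n \<ge> Suc k" for n y
        unfolding P_def using W(3)[OF that(1)] that(2) by (intro prod_zero) auto
      then have "(\<forall>n\<ge>Suc k. \<psi> n y = 0) \<and> (\<Sum>n<Suc k. \<psi> n y) = 1" if "y \<in> W" for y
        using that sum_\<psi>[where N="Suc k"] unfolding \<psi> by simp
      then show ?thesis using W(1,2) by blast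
    qed
  qed
  then show ?thesis by (rule that)
qed

section \<open>Gluing\<close>

lemma sum_half_powers_le:
  assumes "0 \<le> \<tau>"
  shows "(\<Sum>n<N. \<tau> / 2 ^ Suc n) \<le> (\<tau>::real)"
proof -
  have "(\<Sum>n<N. \<tau> / 2 ^ Suc n) = \<tau> * (1 - 1 / 2 ^ N)"
    by (induction N) (simp_all add: field_simps)
  also have "\<dots> \<le> \<tau>" using assms by (simp add: mult_left_le)
  finally show ?thesis .
qed

context sigma_discrete_partition
begin

text \<open>Beyond some \<open>N\<close> any number of terms will do, so two points can be compared
  through finite sums of the same length.\<close>

lemma sum_psi_eventually:
  "\<exists>N. (\<forall>n\<ge>N. \<psi> n x = 0) \<and> (\<forall>N'\<ge>N. (\<Sum>n<N'. \<psi> n x) = 1)"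
proof -
  obtain N where N: "\<forall>n\<ge>N. \<psi> n x = 0" "(\<Sum>n<N. \<psi> n x) = 1"
    using locally_finite_sum[of x] by blast
  have "(\<Sum>n<N'. \<psi> n x) = 1" if "N' \<ge> N" for N'
  proof -
    have "(\<Sum>n<N'. \<psi> n x) = (\<Sum>n<N. \<psi> n x)"
      using that N(1) by (intro sum.mono_neutral_right) auto
    then show ?thesis using N(2) by simp
  qed
  then show ?thesis using N(1) by blast
qed

lemma psi_le_1: "\<psi> n x \<le> 1"
proof -
  obtain N where N: "\<forall>k\<ge>N. (\<Sum>n<k. \<psi> n x) = 1"
    using sum_psi_eventually by blast
  have "\<psi> n x \<le> (\<Sum>k<max N (Suc n). \<psi> k x)"
    by (rule member_le_sum) (auto simp: psi_nonneg)
  then show ?thesis using N by simp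
qed

lemma L_nonneg: "0 \<le> L n"
  using lipschitz_on_nonneg[OF lipschitz_psi] .

text \<open>A zero of the nonnegative function \<open>\<psi> n\<close> is a minimum. Terms with
  \<open>\<psi> n x = 0\<close>, where \<open>\<rho> n x\<close> carries no information, thus
  disappear from derivatives as well.\<close>

lemma psi'_eq_0:
  assumes "\<psi> n x = 0"
  shows "\<psi>' n x = 0"
proof -
  have "(\<psi> n has_derivative \<psi>' n x) (at x)" using C1_psi unfolding C1_deriv_def by blast
  then have "blinfun_apply (\<psi>' n x) = (\<lambda>v. 0)"
    using differential_zero_maxmin[of x UNIV "\<psi> n" "\<psi>' n x"] assms psi_nonneg by simp
  then show ?thesis by (intro blinfun_eqI) simp
qed

text \<open>The index \<open>n\<close> lets the accuracy of an approximation depend on the layer,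
  the index \<open>i\<close> selects the member of the cover. At each point only finitely many terms
  are nonzero.\<close>

definition glue :: "(nat \<Rightarrow> 'i \<Rightarrow> 'a \<Rightarrow> real) \<Rightarrow> 'a \<Rightarrow> real" where
  "glue \<delta> x = (\<Sum>n. \<psi> n x * \<delta> n (\<rho> n x) x)"

lemma glue_eq_sum:
  assumes "\<forall>n\<ge>N. \<psi> n x = 0"
  shows "glue \<delta> x = (\<Sum>n<N. \<psi> n x * \<delta> n (\<rho> n x) x)"
  unfolding glue_def using assms by (intro suminf_finite) auto

lemma glue_minus_eq_sum:
  assumes "\<forall>n\<ge>N. \<psi> n x = 0" "(\<Sum>n<N. \<psi> n x) = 1"
  shows "glue \<delta> x - c = (\<Sum>n<N. \<psi> n x * (\<delta> n (\<rho> n x) x - c))"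
proof -
  have "(\<Sum>n<N. \<psi> n x * (\<delta> n (\<rho> n x) x - c)) = glue \<delta> x - (\<Sum>n<N. \<psi> n x) * c"
    by (simp add: glue_eq_sum[OF assms(1)] right_diff_distrib sum_subtractf sum_distrib_right)
  then show ?thesis using assms(2) by simp
qed

lemma glue_close:
  assumes "\<And>n. \<psi> n x \<noteq> 0 \<Longrightarrow> \<bar>\<delta> n (\<rho> n x) x - c\<bar> \<le> e"
  shows "\<bar>glue \<delta> x - c\<bar> \<le> e"
proof -
  obtain N where N: "\<forall>n\<ge>N. \<psi> n x = 0" "(\<Sum>n<N. \<psi> n x) = 1"
    using sum_psi_eventually by blast
  have "\<bar>glue \<delta> x - c\<bar> \<le> (\<Sum>n<N. \<bar>\<psi> n x * (\<delta> n (\<rho> n x) x - c)\<bar>)"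
    unfolding glue_minus_eq_sum[OF N] by (rule sum_abs)
  also have "\<dots> \<le> (\<Sum>n<N. \<psi> n x * e)"
  proof (rule sum_mono)
    fix n
    show "\<bar>\<psi> n x * (\<delta> n (\<rho> n x) x - c)\<bar> \<le> \<psi> n x * e"
      using assms[of n] psi_nonneg[of n x]
      by (cases "\<psi> n x = 0") (auto simp: abs_mult intro!: mult_left_mono)
  qed
  also have "\<dots> = e" using N(2) by (simp add: sum_distrib_right[symmetric])
  finally show ?thesis .
qed

text \<open>If one weight vanishes, the other equals the difference of the weights and costs
  \<open>\<eta> * L n\<close> per unit of distance. Two points of nonzero weight closer than
  \<open>s n\<close> lie in one piece, and the product can be split as in the product rule. If they
  are at least \<open>s n\<close> apart, the trivial bound \<open>2 * \<eta>\<close> is at most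
  \<open>\<eta> * (2 / s n)\<close> times their distance. The weight is kept in front of
  \<open>\<kappa>\<close> so that summation over \<open>n\<close> yields \<open>\<kappa>\<close>
  only once.\<close>

lemma glue_term_lipschitz:
  assumes xS: "x \<in> S" "y \<in> S"
    and close: "\<And>i z. z \<in> S \<inter> U i \<Longrightarrow> \<bar>\<delta> n i z - F z\<bar> \<le> \<eta>"
    and lipsch: "\<And>i. \<kappa>-lipschitz_on (S \<inter> U i) (\<lambda>z. \<delta> n i z - F z)"
    and \<eta>: "0 \<le> \<eta>" "\<eta> * (L n + 2 / s n) \<le> t"
  shows "\<bar>\<psi> n x * (\<delta> n (\<rho> n x) x - F x) - \<psi> n y * (\<delta> n (\<rho> n y) y - F y)\<bar>
    \<le> (\<psi> n x * \<kappa> + t) * dist x y"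
proof -
  define a where "a = \<delta> n (\<rho> n x) x - F x"
  define b where "b = \<delta> n (\<rho> n y) y - F y"
  have \<kappa>: "0 \<le> \<kappa>" using lipschitz_on_nonneg[OF lipsch] .
  have "\<eta> * L n \<le> \<eta> * (L n + 2 / s n)"
    using \<eta>(1) s_pos[of n] by (intro mult_left_mono) auto
  moreover have "\<eta> * (2 / s n) \<le> \<eta> * (L n + 2 / s n)"
    using \<eta>(1) L_nonneg[of n] by (intro mult_left_mono) auto
  ultimately have \<eta>L: "\<eta> * L n \<le> t" and \<eta>s: "\<eta> * (2 / s n) \<le> t"
    using \<eta>(2) by linarith+
  have t: "0 \<le> t" using \<eta>L \<eta>(1) L_nonneg[of n] mult_nonneg_nonneg[of \<eta> "L n"] by linarith
  have a: "\<bar>a\<bar> \<le> \<eta>" if "\<psi> n x \<noteq> 0"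
    unfolding a_def using close[of x "\<rho> n x"] supp_psi[OF that] xS by blast
  have b: "\<bar>b\<bar> \<le> \<eta>" if "\<psi> n y \<noteq> 0"
    unfolding b_def using close[of y "\<rho> n y"] supp_psi[OF that] xS by blast
  have \<psi>L: "\<bar>\<psi> n x - \<psi> n y\<bar> \<le> L n * dist x y"
    using lipschitz_onD[OF lipschitz_psi, of x y n] by (simp add: dist_real_def)
  have *: "\<bar>\<psi> n x - \<psi> n y\<bar> * \<eta> \<le> t * dist x y"
  proof -
    have "\<bar>\<psi> n x - \<psi> n y\<bar> * \<eta> \<le> L n * dist x y * \<eta>"
      using \<psi>L \<eta>(1) by (rule mult_right_mono)
    also have "\<dots> = (\<eta> * L n) * dist x y" by simp
    also have "\<dots> \<le> t * dist x y" using \<eta>L by (intro mult_right_mono) auto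
    finally show ?thesis .
  qed
  have t_le: "t * dist x y \<le> (\<psi> n x * \<kappa> + t) * dist x y"
    using psi_nonneg[of n x] \<kappa> by (intro mult_right_mono) auto
  have "\<bar>\<psi> n x * a - \<psi> n y * b\<bar> \<le> (\<psi> n x * \<kappa> + t) * dist x y"
  proof (cases "\<psi> n x = 0 \<or> \<psi> n y = 0")
    case True
    have "\<bar>\<psi> n x * a - \<psi> n y * b\<bar> \<le> \<bar>\<psi> n x - \<psi> n y\<bar> * \<eta>"
    proof (cases "\<psi> n x = 0")
      case x0: True
      show ?thesis
        using x0 b \<eta>(1) by (cases "\<psi> n y = 0") (auto simp: abs_mult intro!: mult_left_mono)
    next
      case False
      then show ?thesis
        using True a by (auto simp: abs_mult intro!: mult_left_mono)
    qed
    then show ?thesis using * t_le by linarith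
  next
    case False
    then have x: "\<psi> n x \<noteq> 0" and y: "\<psi> n y \<noteq> 0" by auto
    show ?thesis
    proof (cases "dist x y < s n")
      case True
      have \<rho>: "\<rho> n x = \<rho> n y" using rho_eq[OF x y True] .
      have ab: "\<bar>a - b\<bar> \<le> \<kappa> * dist x y"
        using lipschitz_onD[OF lipsch, of x "\<rho> n x" y] supp_psi[OF x] supp_psi[OF y] xS
        unfolding a_def b_def \<rho> by (simp add: dist_real_def)
      have "\<bar>\<psi> n x * a - \<psi> n y * b\<bar> = \<bar>\<psi> n x * (a - b) + (\<psi> n x - \<psi> n y) * b\<bar>"
        by (simp add: algebra_simps)
      also have "\<dots> \<le> \<psi> n x * \<bar>a - b\<bar> + \<bar>\<psi> n x - \<psi> n y\<bar> * \<bar>b\<bar>"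
        using psi_nonneg[of n x] abs_triangle_ineq[of "\<psi> n x * (a - b)" "(\<psi> n x - \<psi> n y) * b"]
        by (simp add: abs_mult)
      also have "\<dots> \<le> \<psi> n x * (\<kappa> * dist x y) + \<bar>\<psi> n x - \<psi> n y\<bar> * \<eta>"
        using ab b[OF y] psi_nonneg[of n x] by (intro add_mono mult_left_mono) auto
      also have "\<dots> \<le> \<psi> n x * (\<kappa> * dist x y) + t * dist x y"
        using * by simp
      finally show ?thesis by (simp add: algebra_simps)
    next
      case False
      then have far: "s n \<le> dist x y" by simp
      have "\<bar>\<psi> n x * a - \<psi> n y * b\<bar> \<le> \<bar>\<psi> n x * a\<bar> + \<bar>\<psi> n y * b\<bar>"
        by (rule abs_triangle_ineq4)
      also have "\<dots> \<le> 1 * \<eta> + 1 * \<eta>"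
        unfolding abs_mult using a[OF x] b[OF y] psi_nonneg psi_le_1
        by (intro add_mono mult_mono) auto
      also have "\<dots> = \<eta> * (2 / s n) * s n" using s_pos[of n] by simp
      also have "\<dots> \<le> t * dist x y"
        using \<eta>s far t s_pos[of n] by (intro mult_mono) auto
      finally show ?thesis using t_le by linarith
    qed
  qed
  then show ?thesis unfolding a_def b_def .
qed

text \<open>The weights at \<open>x\<close> add up to 1 and the remainders to at most
  \<open>\<tau>\<close>. Points are compared directly and not along a path, so \<open>S\<close> may
  have any shape.\<close>

lemma glue_lipschitz:
  assumes close: "\<And>n i z. z \<in> S \<inter> U i \<Longrightarrow> \<bar>\<delta> n i z - F z\<bar> \<le> \<eta> n"
    and lipsch: "\<And>n i. \<kappa>-lipschitz_on (S \<inter> U i) (\<lambda>z. \<delta> n i z - F z)"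
    and \<eta>: "\<And>n. 0 \<le> \<eta> n" "\<And>n. \<eta> n * (L n + 2 / s n) \<le> \<tau> / 2 ^ Suc n" and \<tau>: "0 \<le> \<tau>"
  shows "(\<kappa> + \<tau>)-lipschitz_on S (\<lambda>x. glue \<delta> x - F x)"
proof (rule lipschitz_onI)
  show "0 \<le> \<kappa> + \<tau>" using lipschitz_on_nonneg[OF lipsch] \<tau> by simp
  fix x y assume xy: "x \<in> S" "y \<in> S"
  obtain N1 where N1: "\<forall>n\<ge>N1. \<psi> n x = 0" "\<forall>N\<ge>N1. (\<Sum>n<N. \<psi> n x) = 1"
    using sum_psi_eventually by blast
  obtain N2 where N2: "\<forall>n\<ge>N2. \<psi> n y = 0" "\<forall>N\<ge>N2. (\<Sum>n<N. \<psi> n y) = 1"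
    using sum_psi_eventually by blast
  define N where "N = max N1 N2"
  have Nx: "\<forall>n\<ge>N. \<psi> n x = 0" "(\<Sum>n<N. \<psi> n x) = 1"
    and Ny: "\<forall>n\<ge>N. \<psi> n y = 0" "(\<Sum>n<N. \<psi> n y) = 1"
    using N1 N2 by (auto simp: N_def)
  have "dist (glue \<delta> x - F x) (glue \<delta> y - F y) =
      \<bar>\<Sum>n<N. \<psi> n x * (\<delta> n (\<rho> n x) x - F x) - \<psi> n y * (\<delta> n (\<rho> n y) y - F y)\<bar>"
    unfolding glue_minus_eq_sum[OF Nx] glue_minus_eq_sum[OF Ny]
    by (simp add: dist_real_def sum_subtractf)
  also have "\<dots> \<le> (\<Sum>n<N. \<bar>\<psi> n x * (\<delta> n (\<rho> n x) x - F x) - \<psi> n y * (\<delta> n (\<rho> n y) y - F y)\<bar>)"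
    by (rule sum_abs)
  also have "\<dots> \<le> (\<Sum>n<N. (\<psi> n x * \<kappa> + \<tau> / 2 ^ Suc n) * dist x y)"
    by (intro sum_mono glue_term_lipschitz[OF xy close lipsch \<eta>])
  also have "\<dots> = ((\<Sum>n<N. \<psi> n x) * \<kappa> + (\<Sum>n<N. \<tau> / 2 ^ Suc n)) * dist x y"
    by (simp only: sum_distrib_right sum.distrib distrib_right)
  also have "\<dots> \<le> (1 * \<kappa> + \<tau>) * dist x y"
    unfolding Nx(2) using sum_half_powers_le[OF \<tau>] by (intro mult_right_mono add_left_mono) auto
  finally show "dist (glue \<delta> x - F x) (glue \<delta> y - F y) \<le> (\<kappa> + \<tau>) * dist x y" by simp
qed

section \<open>Differentiability of the glued function\<close>

lemma rho_locally_constant: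
  "\<exists>i. \<forall>y\<in>ball x (s n / 2). \<psi> n y \<noteq> 0 \<longrightarrow> \<rho> n y = i"
proof (cases "\<exists>z\<in>ball x (s n / 2). \<psi> n z \<noteq> 0")
  case True
  then obtain z where z: "dist x z < s n / 2" "\<psi> n z \<noteq> 0" by auto
  have "\<rho> n y = \<rho> n z" if "y \<in> ball x (s n / 2)" "\<psi> n y \<noteq> 0" for y
  proof -
    \<comment> \<open>Half of \<open>s n\<close>, so that two points of the ball are closer than
      \<open>s n\<close>.\<close>
    have "dist x y < s n / 2" using that by simp
    from dist_triangle_half_r[OF this z(1)] show ?thesis by (rule rho_eq[OF that(2) z(2)])
  qed
  then show ?thesis by blast
qed blast

text \<open>Near a point only finitely many layers are active, and each of them sees a single member
  of the cover, so the glued function is a finite sum of products there. The derivatives of the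
  weights cancel because the weights add up to the constant 1 nearby.\<close>

lemma glue_local:
  assumes \<delta>: "\<And>n i. C1_deriv (\<delta> n i) (\<delta>' n i)"
  shows "\<exists>W h h' N. open W \<and> x \<in> W \<and> C1_deriv h h' \<and> (\<forall>y\<in>W. glue \<delta> y = h y)
    \<and> (\<Sum>n<N. \<psi> n x) = 1 \<and> (\<Sum>n<N. \<psi>' n x) = 0
    \<and> h' x = (\<Sum>n<N. \<psi> n x *\<^sub>R \<delta>' n (\<rho> n x) x + \<delta> n (\<rho> n x) x *\<^sub>R \<psi>' n x)"
proof -
  obtain W N where W: "open W" "x \<in> W"
    and N: "\<And>y n. y \<in> W \<Longrightarrow> n \<ge> N \<Longrightarrow> \<psi> n y = 0" "\<And>y. y \<in> W \<Longrightarrow> (\<Sum>n<N. \<psi> n y) = 1"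
    using locally_finite_sum[of x] by blast
  obtain i where i: "\<And>n y. y \<in> ball x (s n / 2) \<Longrightarrow> \<psi> n y \<noteq> 0 \<Longrightarrow> \<rho> n y = i n"
    using rho_locally_constant[of x] by metis
  \<comment> \<open>The radii may shrink with \<open>n\<close>, but only finitely many balls are
    intersected, so the set stays open.\<close>
  define W' where "W' = W \<inter> (\<Inter>n<N. ball x (s n / 2))"
  have W': "open W'" "x \<in> W'"
    unfolding W'_def using W s_pos by (auto intro!: open_Int open_INT)
  define h where "h y = (\<Sum>n<N. \<psi> n y * \<delta> n (i n) y)" for y
  define h' where "h' y = (\<Sum>n<N. \<psi> n y *\<^sub>R \<delta>' n (i n) y + \<delta> n (i n) y *\<^sub>R \<psi>' n y)" for y
  have h: "C1_deriv h h'"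
    unfolding h_def[abs_def] h'_def[abs_def] by (intro C1_deriv_sum C1_deriv_mult C1_psi \<delta>)
  have eq: "glue \<delta> y = h y" if y: "y \<in> W'" for y
  proof -
    have "glue \<delta> y = (\<Sum>n<N. \<psi> n y * \<delta> n (\<rho> n y) y)"
      using y N(1)[of y] unfolding W'_def by (intro glue_eq_sum) auto
    also have "\<dots> = h y"
      unfolding h_def
    proof (rule sum.cong)
      fix n assume "n \<in> {..<N}"
      then show "\<psi> n y * \<delta> n (\<rho> n y) y = \<psi> n y * \<delta> n (i n) y"
        using i[of y n] y unfolding W'_def by (cases "\<psi> n y = 0") auto
    qed simp
    finally show ?thesis .
  qed
  have "C1_deriv (\<lambda>y. \<Sum>n<N. \<psi> n y) (\<lambda>y. \<Sum>n<N. \<psi>' n y)"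
    by (intro C1_deriv_sum C1_psi)
  from C1_deriv_unique_on_open[OF this C1_deriv_const W] N(2)
  have "(\<Sum>n<N. \<psi>' n x) = 0" by blast
  moreover have "h' x = (\<Sum>n<N. \<psi> n x *\<^sub>R \<delta>' n (\<rho> n x) x + \<delta> n (\<rho> n x) x *\<^sub>R \<psi>' n x)"
    unfolding h'_def
  proof (rule sum.cong)
    fix n
    show "\<psi> n x *\<^sub>R \<delta>' n (i n) x + \<delta> n (i n) x *\<^sub>R \<psi>' n x
        = \<psi> n x *\<^sub>R \<delta>' n (\<rho> n x) x + \<delta> n (\<rho> n x) x *\<^sub>R \<psi>' n x"
    proof (cases "\<psi> n x = 0")
      case False
      then have "\<rho> n x = i n" using i[of x n] s_pos by simp
      then show ?thesis by simp
    qed (simp add: psi'_eq_0)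
  qed simp
  ultimately show ?thesis
    using W' h eq N(2)[OF W(2)] by blast
qed

lemma glue_C1:
  assumes \<delta>: "\<And>n i. C1_deriv (\<delta> n i) (\<delta>' n i)"
  obtains G' where "C1_deriv (glue \<delta>) G'"
proof -
  have "\<exists>W h h'. open W \<and> x \<in> W \<and> C1_deriv h h' \<and> (\<forall>y\<in>W. glue \<delta> y = h y)" for x
    using glue_local[of \<delta> \<delta>' x, OF \<delta>] by blast
  then obtain G' where "C1_deriv (glue \<delta>) G'" by (rule C1_deriv_local)
  then show ?thesis by (rule that)
qed

text \<open>Since the derivatives of the weights sum to 0, the constant \<open>c\<close> can be
  subtracted from the approximations that multiply them; the errors \<open>\<eta> n\<close> then
  absorb the bounds \<open>L n\<close> of these derivatives.\<close>

lemma glue_deriv_close: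
  assumes \<delta>: "\<And>n i. C1_deriv (\<delta> n i) (\<delta>' n i)" and G': "C1_deriv (glue \<delta>) G'"
    and close: "\<And>n. \<psi> n x \<noteq> 0 \<Longrightarrow> \<bar>\<delta> n (\<rho> n x) x - c\<bar> \<le> \<eta> n"
    and deriv_close: "\<And>n. \<psi> n x \<noteq> 0 \<Longrightarrow> \<bar>\<delta>' n (\<rho> n x) x v - a\<bar> \<le> \<kappa> * norm v"
    and \<eta>: "\<And>n. 0 \<le> \<eta> n" "\<And>n. \<eta> n * (L n + 2 / s n) \<le> \<tau> / 2 ^ Suc n" and \<tau>: "0 \<le> \<tau>"
  shows "\<bar>G' x v - a\<bar> \<le> (\<kappa> + \<tau>) * norm v"
proof -
  obtain W h h' N where W: "open W" "x \<in> W" and h: "C1_deriv h h'" and eq: "\<And>y. y \<in> W \<Longrightarrow> glue \<delta> y = h y"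
    and N: "(\<Sum>n<N. \<psi> n x) = 1" "(\<Sum>n<N. \<psi>' n x) = 0"
    and h'x: "h' x = (\<Sum>n<N. \<psi> n x *\<^sub>R \<delta>' n (\<rho> n x) x + \<delta> n (\<rho> n x) x *\<^sub>R \<psi>' n x)"
    using glue_local[of \<delta> \<delta>' x, OF \<delta>] by blast
  have "G' x = h' x" using C1_deriv_unique_on_open[OF G' h W eq] .
  then have "G' x v = (\<Sum>n<N. \<psi> n x * \<delta>' n (\<rho> n x) x v + \<delta> n (\<rho> n x) x * \<psi>' n x v)"
    unfolding h'x by (simp add: blinfun.sum_left blinfun.add_left blinfun.scaleR_left)
  moreover have "(\<Sum>n<N. \<psi>' n x v) = 0"
    using N(2) by (metis blinfun.sum_left zero_blinfun.rep_eq)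
  ultimately have "G' x v - a =
      (\<Sum>n<N. \<psi> n x * (\<delta>' n (\<rho> n x) x v - a) + (\<delta> n (\<rho> n x) x - c) * \<psi>' n x v)"
    using N(1) by (simp add: algebra_simps sum.distrib sum_subtractf sum_distrib_left[symmetric])
  also have "\<bar>\<dots>\<bar> \<le> (\<Sum>n<N. \<bar>\<psi> n x * (\<delta>' n (\<rho> n x) x v - a) + (\<delta> n (\<rho> n x) x - c) * \<psi>' n x v\<bar>)"
    by (rule sum_abs)
  also have "\<dots> \<le> (\<Sum>n<N. (\<psi> n x * \<kappa> + \<tau> / 2 ^ Suc n) * norm v)"
  proof (rule sum_mono)
    fix n
    show "\<bar>\<psi> n x * (\<delta>' n (\<rho> n x) x v - a) + (\<delta> n (\<rho> n x) x - c) * \<psi>' n x v\<bar>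
        \<le> (\<psi> n x * \<kappa> + \<tau> / 2 ^ Suc n) * norm v"
    proof (cases "\<psi> n x = 0")
      case True
      then show ?thesis using \<tau> by (simp add: psi'_eq_0)
    next
      case False
      have \<psi>': "\<bar>\<psi>' n x v\<bar> \<le> L n * norm v"
        using norm_blinfun[of "\<psi>' n x" v]
          mult_right_mono[OF C1_deriv_norm_le[OF C1_psi lipschitz_psi] norm_ge_zero, of n x v]
        by simp
      have "\<eta> n * L n \<le> \<eta> n * (L n + 2 / s n)"
        using \<eta>(1) s_pos[of n] by (intro mult_left_mono) auto
      then have \<eta>L: "\<eta> n * L n \<le> \<tau> / 2 ^ Suc n" using \<eta>(2)[of n] by linarith
      have "\<bar>\<psi> n x * (\<delta>' n (\<rho> n x) x v - a) + (\<delta> n (\<rho> n x) x - c) * \<psi>' n x v\<bar>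
          \<le> \<psi> n x * \<bar>\<delta>' n (\<rho> n x) x v - a\<bar> + \<bar>\<delta> n (\<rho> n x) x - c\<bar> * \<bar>\<psi>' n x v\<bar>"
        using psi_nonneg[of n x] by (metis abs_mult abs_of_nonneg abs_triangle_ineq)
      also have "\<dots> \<le> \<psi> n x * (\<kappa> * norm v) + \<eta> n * (L n * norm v)"
        using deriv_close[OF False] close[OF False] \<psi>' psi_nonneg[of n x] \<eta>(1)
        by (intro add_mono mult_mono mult_left_mono) auto
      also have "\<dots> \<le> \<psi> n x * (\<kappa> * norm v) + (\<tau> / 2 ^ Suc n) * norm v"
        unfolding mult.assoc[symmetric, of "\<eta> n"] using \<eta>L
        by (intro add_left_mono mult_right_mono) auto
      finally show ?thesis by (simp add: algebra_simps)
    qed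
  qed
  also have "\<dots> = ((\<Sum>n<N. \<psi> n x) * \<kappa> + (\<Sum>n<N. \<tau> / 2 ^ Suc n)) * norm v"
    by (simp only: sum_distrib_right sum.distrib distrib_right)
  also have "\<dots> \<le> (1 * \<kappa> + \<tau>) * norm v"
    unfolding N(1) using sum_half_powers_le[OF \<tau>] by (intro mult_right_mono add_left_mono) auto
  finally show ?thesis by simp
qed

end

section \<open>The approximation theorem\<close>

lemma blinfun_lipschitz: "(norm T)-lipschitz_on S (blinfun_apply T)"
proof (rule lipschitz_onI)
  fix x y
  show "dist (T x) (T y) \<le> norm T * dist x y"
    using norm_blinfun[of T "x - y"] by (simp add: dist_norm blinfun.diff_right)
qed simp

text \<open>Differences of points of \<open>Y\<close> lie in \<open>Zsp Y\<close>, where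
  \<open>T\<close> is \<open>D p\<close>; so condition (E) at \<open>p\<close> bounds the constant
  of \<open>f - T\<close>, and continuity of \<open>D\<close> carries the comparison of
  \<open>T\<close> from \<open>D p\<close> to the nearby \<open>D y\<close>.\<close>

lemma local_linearization:
  fixes Y :: "'a::real_normed_vector set"
  assumes D: "cont_dual_map Y D" and E: "condE Y f D" and \<kappa>: "\<kappa> > 0" and p: "p \<in> Y"
  obtains r T where "r > 0" "norm T \<le> dual_norm (Zsp Y) (D p)"
    "\<forall>y\<in>Y \<inter> ball p r. \<forall>z\<in>Zsp Y. \<bar>blinfun_apply T z - D y z\<bar> \<le> \<kappa> * norm z"
    "\<kappa>-lipschitz_on (Y \<inter> ball p r) (\<lambda>x. f x - blinfun_apply T x)"
proof -
  have dual: "in_dual (Zsp Y) (D y)" if "y \<in> Y" for y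
    using D that unfolding cont_dual_map_def by blast
  obtain T :: "'a \<Rightarrow>\<^sub>L real" where T: "\<forall>z\<in>Zsp Y. T z = D p z" and nT: "norm T \<le> dual_norm (Zsp Y) (D p)"
  proof (rule hahn_banach_normed[OF subspace_Zsp])
    show "D p (u + v) = D p u + D p v" if "u \<in> Zsp Y" "v \<in> Zsp Y" for u v
      using dual[OF p] that unfolding in_dual_def by blast
    show "D p (c *\<^sub>R u) = c * D p u" if "u \<in> Zsp Y" for u c
      using dual[OF p] that unfolding in_dual_def by blast
    show "\<bar>D p z\<bar> \<le> dual_norm (Zsp Y) (D p) * norm z" if "z \<in> Zsp Y" for z
      using dual_norm_bound[OF subspace_Zsp dual[OF p] that] .
    show "0 \<le> dual_norm (Zsp Y) (D p)" using dual_norm_nonneg[OF dual[OF p]] .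
  qed
  obtain d where d: "d > 0"
    "\<And>y. y \<in> Y \<Longrightarrow> dist y p < d \<Longrightarrow> dual_norm (Zsp Y) (\<lambda>z. D y z - D p z) < \<kappa>"
    using D p \<kappa> unfolding cont_dual_map_def by blast
  obtain r where r: "r > 0" "\<And>z w. z \<in> Y \<inter> ball p r \<Longrightarrow> w \<in> Y \<inter> ball p r \<Longrightarrow>
      \<bar>f z - f w - D p (z - w)\<bar> \<le> \<kappa> * norm (z - w)"
    using E p \<kappa> unfolding condE_def by metis
  show ?thesis
  proof
    show "min d r > 0" using d r by simp
    show "norm T \<le> dual_norm (Zsp Y) (D p)" by (rule nT)
    show "\<forall>y\<in>Y \<inter> ball p (min d r). \<forall>z\<in>Zsp Y. \<bar>T z - D y z\<bar> \<le> \<kappa> * norm z"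
    proof (intro ballI)
      fix y z assume y: "y \<in> Y \<inter> ball p (min d r)" and z: "z \<in> Zsp Y"
      then have yY: "y \<in> Y" and "dist y p < d" by (auto simp: dist_commute)
      have "\<bar>D y z - D p z\<bar> \<le> dual_norm (Zsp Y) (\<lambda>z. D y z - D p z) * norm z"
        by (rule dual_norm_bound[OF subspace_Zsp in_dual_diff[OF dual[OF yY] dual[OF p]] z])
      also have "\<dots> \<le> \<kappa> * norm z"
        using d(2)[OF yY \<open>dist y p < d\<close>] by (intro mult_right_mono) auto
      finally show "\<bar>T z - D y z\<bar> \<le> \<kappa> * norm z"
        using T z by (simp add: abs_minus_commute)
    qed
    show "\<kappa>-lipschitz_on (Y \<inter> ball p (min d r)) (\<lambda>x. f x - T x)"
    proof (rule lipschitz_onI)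
      fix x w assume xw: "x \<in> Y \<inter> ball p (min d r)" "w \<in> Y \<inter> ball p (min d r)"
      then have "T (x - w) = D p (x - w)" using T diff_in_Zsp by blast
      then have "(f x - T x) - (f w - T w) = f x - f w - D p (x - w)"
        by (simp add: blinfun.diff_right)
      then show "dist (f x - T x) (f w - T w) \<le> \<kappa> * dist x w"
        using r(2)[of x w] xw by (simp add: dist_norm)
    qed (use \<kappa> in simp)
  qed
qed

text \<open>Under \<open>P\<close> the remainder is \<open>H = F - T\<close> on the whole space, and
  this exact decomposition is what a global Lipschitz bound requires. Without \<open>P\<close> the
  function \<open>F\<close> is merely continuous, and near \<open>Y\<close> the remainder is an
  extension of \<open>f - T\<close> from a part of \<open>Y\<close>.\<close>

lemma local_decomposition:
  fixes Y :: "'a::real_normed_vector set"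
  assumes Y: "closed Y" and D: "cont_dual_map Y D" and E: "condE Y f D"
    and F: "continuous_on UNIV F" "\<forall>y\<in>Y. F y = f y" and \<kappa>: "\<kappa> > 0" and e: "e > 0"
    and lipF: "P \<Longrightarrow> LF-lipschitz_on UNIV F"
    and M: "P \<Longrightarrow> 0 \<le> M" "\<And>y. P \<Longrightarrow> y \<in> Y \<Longrightarrow> dual_norm (Zsp Y) (D y) \<le> M"
  shows "\<exists>V T H. open V \<and> p \<in> V \<and> (\<exists>L. L-lipschitz_on UNIV H) \<and> \<kappa>-lipschitz_on (Y \<inter> V) H \<and>
    (\<forall>x\<in>Y \<inter> V. H x + blinfun_apply T x = f x) \<and> (\<forall>x\<in>V. \<bar>H x + blinfun_apply T x - F x\<bar> < e) \<and>
    (\<forall>y\<in>Y \<inter> V. \<forall>z\<in>Zsp Y. \<bar>blinfun_apply T z - D y z\<bar> \<le> \<kappa> * norm z) \<and>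
    (P \<longrightarrow> norm T \<le> M \<and> (\<forall>x. H x + blinfun_apply T x = F x))"
proof (cases "p \<in> Y")
  case True
  obtain r T where r: "r > 0" and nT: "norm T \<le> dual_norm (Zsp Y) (D p)"
    and T: "\<forall>y\<in>Y \<inter> ball p r. \<forall>z\<in>Zsp Y. \<bar>blinfun_apply T z - D y z\<bar> \<le> \<kappa> * norm z"
    and lip: "\<kappa>-lipschitz_on (Y \<inter> ball p r) (\<lambda>x. f x - blinfun_apply T x)"
    using local_linearization[OF D E \<kappa> True] .
  have "\<exists>H L. L-lipschitz_on UNIV H \<and> (\<forall>x\<in>Y \<inter> ball p r. H x = f x - T x) \<and> (P \<longrightarrow> (\<forall>x. H x = F x - T x))"
  proof (cases P)
    case True
    have "(LF + norm T)-lipschitz_on UNIV (\<lambda>x. F x - T x)"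
      by (intro lipschitz_on_diff lipF True blinfun_lipschitz)
    moreover have "\<forall>x\<in>Y \<inter> ball p r. F x - T x = f x - T x" using F(2) by simp
    ultimately show ?thesis by blast
  next
    case False
    obtain H where "\<kappa>-lipschitz_on UNIV H" "\<forall>x\<in>Y \<inter> ball p r. H x = f x - T x"
      using lipschitz_extension_mcshane[OF lip] .
    then show ?thesis using False by blast
  qed
  then obtain H L where H: "L-lipschitz_on UNIV H" and Hf: "\<forall>x\<in>Y \<inter> ball p r. H x = f x - T x"
    and HF: "P \<Longrightarrow> \<forall>x. H x = F x - T x" by blast
  \<comment> \<open>\<open>H + T\<close> and \<open>F\<close> are continuous and agree at
    \<open>p\<close>, so cutting the ball down to where they differ by less than \<open>e\<close>
    leaves a neighbourhood of \<open>p\<close>.\<close>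
  define V where "V = ball p r \<inter> {x. \<bar>H x + T x - F x\<bar> < e}"
  have "open {x. \<bar>H x + T x - F x\<bar> < e}"
    using lipschitz_on_continuous_on[OF H] F(1)
    by (intro open_Collect_less continuous_intros)
  then have "open V" unfolding V_def by auto
  moreover have "p \<in> V"
    using True r Hf F(2) e unfolding V_def by simp
  moreover have "\<kappa>-lipschitz_on (Y \<inter> V) H"
  proof -
    have "\<kappa>-lipschitz_on (Y \<inter> V) (\<lambda>x. f x - T x)"
      by (rule lipschitz_on_subset[OF lip]) (auto simp: V_def)
    then show ?thesis
      by (rule lipschitz_on_transform) (use Hf in \<open>auto simp: V_def\<close>)
  qed
  moreover have "\<forall>x\<in>Y \<inter> V. H x + T x = f x" using Hf unfolding V_def by simp
  moreover have "\<forall>x\<in>V. \<bar>H x + T x - F x\<bar> < e" unfolding V_def by simp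
  moreover have "\<forall>y\<in>Y \<inter> V. \<forall>z\<in>Zsp Y. \<bar>T z - D y z\<bar> \<le> \<kappa> * norm z" using T unfolding V_def by simp
  moreover have "P \<longrightarrow> norm T \<le> M \<and> (\<forall>x. H x + T x = F x)"
    using nT M(2)[OF _ True] HF by force
  ultimately show ?thesis using H by blast
next
  case False
  have "\<exists>H L. L-lipschitz_on UNIV H \<and> H p = F p \<and> (P \<longrightarrow> H = F)"
    using lipF lipschitz_on_constant[of UNIV "F p"] by (cases P) blast+
  then obtain H L where H: "L-lipschitz_on UNIV H" "H p = F p" "P \<longrightarrow> H = F" by blast
  \<comment> \<open>Off the closed set \<open>Y\<close>, a neighbourhood missing \<open>Y\<close>
    makes the conditions on \<open>Y \<inter> V\<close> vacuous, so the functional can be 0.\<close>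
  define V where "V = - Y \<inter> {x. \<bar>H x + blinfun_apply 0 x - F x\<bar> < e}"
  have "open {x. \<bar>H x + blinfun_apply 0 x - F x\<bar> < e}"
    using lipschitz_on_continuous_on[OF H(1)] F(1)
    by (intro open_Collect_less continuous_intros)
  then have "open V" using Y unfolding V_def by auto
  moreover have "p \<in> V" using False H(2) e unfolding V_def by simp
  moreover have "Y \<inter> V = {}" unfolding V_def by blast
  moreover have "\<forall>x\<in>V. \<bar>H x + blinfun_apply 0 x - F x\<bar> < e" unfolding V_def by simp
  moreover have "P \<longrightarrow> norm (0 :: 'a \<Rightarrow>\<^sub>L real) \<le> M \<and> (\<forall>x. H x + blinfun_apply 0 x = F x)"
    using M(1) H(3) by simp
  ultimately show ?thesis using H(1) \<kappa>
    by (intro exI[of _ V] exI[of _ "0 :: 'a \<Rightarrow>\<^sub>L real"] exI[of _ H]) auto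
qed

lemma smooth_approximation_nonneg:
  fixes Y :: "'a::real_normed_vector set"
  assumes star: "star_const TYPE('a) C0" and C0: "0 \<le> C0"
    and Y: "closed Y" and D: "cont_dual_map Y D" and E: "condE Y f D"
    and F: "continuous_on UNIV F" "\<forall>y\<in>Y. F y = f y" and \<epsilon>: "\<epsilon> > 0"
    and lipF: "P \<Longrightarrow> LF-lipschitz_on UNIV F"
    and M: "P \<Longrightarrow> 0 \<le> M" "\<And>y. P \<Longrightarrow> y \<in> Y \<Longrightarrow> dual_norm (Zsp Y) (D y) \<le> M"
  obtains G G' where "C1_deriv G G'" "\<forall>x. \<bar>F x - G x\<bar> < \<epsilon>"
    "\<forall>y\<in>Y. dual_norm (Zsp Y) (\<lambda>z. D y z - G' y z) < \<epsilon>"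
    "(\<epsilon> / 4)-lipschitz_on Y (\<lambda>y. f y - G y)"
    "P \<longrightarrow> (35 * C0 * (LF + M) + M + LF + \<epsilon> / 8 + LF)-lipschitz_on UNIV G"
proof -
  \<comment> \<open>On \<open>Y\<close> the smoothed remainder costs \<open>C0 * \<kappa>\<close>
    and the linearization \<open>\<kappa>\<close>, together \<open>\<epsilon> / 8\<close>; gluing
    costs another \<open>\<epsilon> / 8\<close>.\<close>
  define \<kappa> where "\<kappa> = \<epsilon> / 8 / (C0 + 1)"
  have \<kappa>: "\<kappa> > 0" unfolding \<kappa>_def using \<epsilon> C0 by simp
  have C0\<kappa>: "C0 * \<kappa> + \<kappa> = \<epsilon> / 8"
  proof -
    have "C0 + 1 \<noteq> 0" using C0 by linarith
    from nonzero_eq_divide_eq[OF this] \<kappa>_def have "\<kappa> * (C0 + 1) = \<epsilon> / 8" by blast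
    then show ?thesis by (simp add: algebra_simps)
  qed
  have "\<epsilon> / 2 > 0" using \<epsilon> by simp
  note dec = local_decomposition[OF Y D E F \<kappa> this lipF M, of P]
  obtain V T H where V: "\<And>p. open (V p)" "\<And>p. p \<in> V p"
    and H: "\<And>p. \<exists>L. L-lipschitz_on UNIV (H p)" "\<And>p. \<kappa>-lipschitz_on (Y \<inter> V p) (H p)"
    and HTf: "\<And>p x. x \<in> Y \<inter> V p \<Longrightarrow> H p x + blinfun_apply (T p) x = f x"
    and HTF: "\<And>p x. x \<in> V p \<Longrightarrow> \<bar>H p x + blinfun_apply (T p) x - F x\<bar> < \<epsilon> / 2"
    and TD: "\<And>p y z. y \<in> Y \<inter> V p \<Longrightarrow> z \<in> Zsp Y \<Longrightarrow> \<bar>blinfun_apply (T p) z - D y z\<bar> \<le> \<kappa> * norm z"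
    and T: "\<And>p. P \<Longrightarrow> norm (T p) \<le> M" "\<And>p x. P \<Longrightarrow> H p x + blinfun_apply (T p) x = F x"
    using dec by metis
  have cover: "(\<Union>p. V p) = UNIV" using V(2) by blast
  obtain \<psi> \<psi>' \<rho> L s where "sigma_discrete_partition V \<psi> \<psi>' \<rho> L s"
    by (rule sigma_discrete_partition_exists[OF star, of V, OF V(1) cover])
  then interpret sigma_discrete_partition V \<psi> \<psi>' \<rho> L s .
  have Ls: "L n + 2 / s n > 0" for n
    using L_nonneg[of n] s_pos[of n] by (intro add_nonneg_pos) auto
  \<comment> \<open>The bound \<open>\<epsilon> / 4\<close> is for uniform closeness, on top of the
    \<open>\<epsilon> / 2\<close> from the decomposition; the other one pays for gluing.
    \<open>L\<close> and \<open>s\<close> are already fixed by the partition, the approximations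
    \<open>K\<close> are not yet chosen.\<close>
  define \<eta> where "\<eta> n = min (\<epsilon> / 4) ((\<epsilon> / 8) / 2 ^ Suc n / (L n + 2 / s n))" for n
  have \<eta>_pos: "\<eta> n > 0" for n
    unfolding \<eta>_def using \<epsilon> Ls by simp
  have \<eta>_le: "\<eta> n \<le> \<epsilon> / 4" for n unfolding \<eta>_def by simp
  have \<eta>_L: "\<eta> n * (L n + 2 / s n) \<le> (\<epsilon> / 8) / 2 ^ Suc n" for n
  proof -
    have "\<eta> n * (L n + 2 / s n) \<le> (\<epsilon> / 8) / 2 ^ Suc n / (L n + 2 / s n) * (L n + 2 / s n)"
      unfolding \<eta>_def using Ls[of n] by (intro mult_right_mono) auto
    then show ?thesis using Ls[of n] by simp
  qed
  note \<eta> = less_imp_le[OF \<eta>_pos] \<eta>_L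
  have \<tau>: "0 \<le> \<epsilon> / 8" using \<epsilon> by simp
  have "\<forall>n p. \<exists>K K'. C1_deriv K K' \<and> (\<forall>x. \<bar>H p x - K x\<bar> \<le> \<eta> n) \<and>
      (C0 * \<kappa>)-lipschitz_on (Y \<inter> V p) K \<and> (\<forall>y\<in>Y \<inter> V p. norm (K' y) \<le> C0 * \<kappa>) \<and>
      (35 * C0 * lip UNIV (H p))-lipschitz_on UNIV K"
  proof (intro allI)
    fix n p
    obtain LH where LH: "LH-lipschitz_on UNIV (H p)" using H(1) by blast
    obtain K K' where K: "C1_deriv K K'" "\<forall>x. \<bar>H p x - K x\<bar> \<le> \<eta> n"
      "(C0 * lip (Y \<inter> V p) (H p))-lipschitz_on (Y \<inter> V p) K"
      "\<forall>y\<in>Y \<inter> V p. norm (K' y) \<le> C0 * lip (Y \<inter> V p) (H p)"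
      "(35 * C0 * lip UNIV (H p))-lipschitz_on UNIV K"
      using C1_prop_of_star_const_nonneg[OF star C0, unfolded C1_prop_def, rule_format, of LH "H p" "\<eta> n" "Y \<inter> V p"]
        LH \<eta>_pos by blast
    have le: "C0 * lip (Y \<inter> V p) (H p) \<le> C0 * \<kappa>"
      by (intro mult_left_mono lip_le H(2) C0)
    show "\<exists>K K'. C1_deriv K K' \<and> (\<forall>x. \<bar>H p x - K x\<bar> \<le> \<eta> n) \<and>
      (C0 * \<kappa>)-lipschitz_on (Y \<inter> V p) K \<and> (\<forall>y\<in>Y \<inter> V p. norm (K' y) \<le> C0 * \<kappa>) \<and>
      (35 * C0 * lip UNIV (H p))-lipschitz_on UNIV K"
      using K(1,2,5) lipschitz_on_mono[OF K(3) subset_refl le] K(4) le order_trans by blast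
  qed
  then obtain K K' where KK: "\<forall>n p. C1_deriv (K n p) (K' n p) \<and> (\<forall>x. \<bar>H p x - K n p x\<bar> \<le> \<eta> n) \<and>
      (C0 * \<kappa>)-lipschitz_on (Y \<inter> V p) (K n p) \<and> (\<forall>y\<in>Y \<inter> V p. norm (K' n p y) \<le> C0 * \<kappa>) \<and>
      (35 * C0 * lip UNIV (H p))-lipschitz_on UNIV (K n p)"
    unfolding choice_iff by blast
  have K: "C1_deriv (K n p) (K' n p)" and HK: "\<bar>H p x - K n p x\<bar> \<le> \<eta> n"
    and KY: "(C0 * \<kappa>)-lipschitz_on (Y \<inter> V p) (K n p)"
    and K': "y \<in> Y \<inter> V p \<Longrightarrow> norm (K' n p y) \<le> C0 * \<kappa>"
    and LK: "(35 * C0 * lip UNIV (H p))-lipschitz_on UNIV (K n p)" for n p x y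
    using KK by blast+
  define \<delta> where "\<delta> n p x = K n p x + T p x" for n p x
  define \<delta>' where "\<delta>' n p x = K' n p x + T p" for n p x
  have \<delta>: "C1_deriv (\<delta> n p) (\<delta>' n p)" for n p
    unfolding \<delta>_def[abs_def] \<delta>'_def[abs_def] by (intro C1_deriv_add K C1_deriv_blinfun)
  obtain G' where G': "C1_deriv (glue \<delta>) G'" using glue_C1[of \<delta> \<delta>', OF \<delta>] .
  have \<delta>f: "\<bar>\<delta> n p x - f x\<bar> \<le> \<eta> n" if "x \<in> Y \<inter> V p" for n p x
    unfolding \<delta>_def HTf[OF that, symmetric] using HK[of p x n] by (simp add: abs_minus_commute)
  show ?thesis
  proof (rule that[OF G'])
    show "\<forall>x. \<bar>F x - glue \<delta> x\<bar> < \<epsilon>"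
    proof
      fix x
      have "\<bar>glue \<delta> x - F x\<bar> \<le> 3 * \<epsilon> / 4"
      proof (rule glue_close)
        fix n assume "\<psi> n x \<noteq> 0"
        then have "\<bar>H (\<rho> n x) x + T (\<rho> n x) x - F x\<bar> < \<epsilon> / 2" by (intro HTF supp_psi)
        then show "\<bar>\<delta> n (\<rho> n x) x - F x\<bar> \<le> 3 * \<epsilon> / 4"
          using HK[of "\<rho> n x" x n] \<eta>_le[of n] unfolding \<delta>_def by linarith
      qed
      then show "\<bar>F x - glue \<delta> x\<bar> < \<epsilon>" using \<epsilon> by linarith
    qed
    show "\<forall>y\<in>Y. dual_norm (Zsp Y) (\<lambda>z. D y z - G' y z) < \<epsilon>"
    proof
      fix y assume y: "y \<in> Y"
      have "dual_norm (Zsp Y) (\<lambda>z. D y z - G' y z) \<le> \<epsilon> / 8 + \<epsilon> / 8"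
      proof (rule dual_norm_le)
        fix z assume z: "z \<in> Zsp Y"
        have "\<bar>G' y z - D y z\<bar> \<le> (\<epsilon> / 8 + \<epsilon> / 8) * norm z"
        proof (rule glue_deriv_close[OF \<delta> G' _ _ \<eta> \<tau>])
          fix n assume "\<psi> n y \<noteq> 0"
          then have yV: "y \<in> Y \<inter> V (\<rho> n y)" using y supp_psi by blast
          then show "\<bar>\<delta> n (\<rho> n y) y - f y\<bar> \<le> \<eta> n" by (rule \<delta>f)
          have "\<bar>K' n (\<rho> n y) y z\<bar> \<le> C0 * \<kappa> * norm z"
            using norm_blinfun[of "K' n (\<rho> n y) y" z] mult_right_mono[OF K'[OF yV, of n] norm_ge_zero[of z]]
            by simp
          moreover have "\<bar>T (\<rho> n y) z - D y z\<bar> \<le> \<kappa> * norm z" by (rule TD[OF yV z])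
          ultimately have "\<bar>\<delta>' n (\<rho> n y) y z - D y z\<bar> \<le> C0 * \<kappa> * norm z + \<kappa> * norm z"
            unfolding \<delta>'_def blinfun.add_left by linarith
          then show "\<bar>\<delta>' n (\<rho> n y) y z - D y z\<bar> \<le> \<epsilon> / 8 * norm z"
            by (simp only: C0\<kappa>[symmetric] distrib_right)
        qed
        then show "\<bar>D y z - G' y z\<bar> \<le> (\<epsilon> / 8 + \<epsilon> / 8) * norm z"
          by (simp add: abs_minus_commute)
      qed (use \<epsilon> in simp)
      then show "dual_norm (Zsp Y) (\<lambda>z. D y z - G' y z) < \<epsilon>" using \<epsilon> by linarith
    qed
    have "(\<epsilon> / 8 + \<epsilon> / 8)-lipschitz_on Y (\<lambda>x. glue \<delta> x - f x)"
    proof (rule glue_lipschitz[OF \<delta>f _ \<eta> \<tau>])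
      fix n p
      \<comment> \<open>On \<open>Y \<inter> V p\<close> the functional \<open>T p\<close> cancels
        between \<open>\<delta> n p\<close> and \<open>f\<close>, which leaves the smoothing error
        \<open>K n p - H p\<close>.\<close>
      have "(C0 * \<kappa> + \<kappa>)-lipschitz_on (Y \<inter> V p) (\<lambda>x. K n p x - H p x)"
        by (intro lipschitz_on_diff KY H(2))
      then have "(\<epsilon> / 8)-lipschitz_on (Y \<inter> V p) (\<lambda>x. K n p x - H p x)" unfolding C0\<kappa> .
      then show "(\<epsilon> / 8)-lipschitz_on (Y \<inter> V p) (\<lambda>x. \<delta> n p x - f x)"
        by (rule lipschitz_on_transform) (use HTf[of _ p] in \<open>force simp: \<delta>_def\<close>)
    qed
    then show "(\<epsilon> / 4)-lipschitz_on Y (\<lambda>y. f y - glue \<delta> y)"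
      using lipschitz_on_minus[of "\<epsilon> / 4" Y "\<lambda>x. glue \<delta> x - f x"] by simp
    show "P \<longrightarrow> (35 * C0 * (LF + M) + M + LF + \<epsilon> / 8 + LF)-lipschitz_on UNIV (glue \<delta>)"
    proof
      assume P
      note T = T[OF this] and LF = lipF[OF this]
      have \<delta>F: "\<bar>\<delta> n p x - F x\<bar> \<le> \<eta> n" for n p x
        unfolding \<delta>_def T(2)[of p x, symmetric] using HK[of p x n] by (simp add: abs_minus_commute)
      \<comment> \<open>The constant of \<open>F\<close> is paid twice beyond its share in
        \<open>H p\<close>: in the local differences \<open>\<delta> n p - F\<close>, and again when
        \<open>F\<close> is added back.\<close>
      have "(35 * C0 * (LF + M) + M + LF + \<epsilon> / 8)-lipschitz_on UNIV (\<lambda>x. glue \<delta> x - F x)"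
      proof (rule glue_lipschitz[OF \<delta>F _ \<eta> \<tau>])
        fix n p
        have TM: "M-lipschitz_on UNIV (T p)"
          by (rule lipschitz_on_mono[OF blinfun_lipschitz subset_refl T(1)])
        have "H p = (\<lambda>x. F x - T p x)"
          using T(2)[of p] by (auto simp: fun_eq_iff algebra_simps)
        then have "(LF + M)-lipschitz_on UNIV (H p)"
          using lipschitz_on_diff[OF LF TM] by simp
        then have "lip UNIV (H p) \<le> LF + M" by (rule lip_le)
        then have "35 * C0 * lip UNIV (H p) \<le> 35 * C0 * (LF + M)"
          using C0 by (intro mult_left_mono) auto
        from lipschitz_on_mono[OF LK subset_refl this]
        have "(35 * C0 * (LF + M) + M + LF)-lipschitz_on UNIV (\<lambda>x. \<delta> n p x - F x)"
          unfolding \<delta>_def by (intro lipschitz_on_diff lipschitz_on_add TM LF)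
        then show "(35 * C0 * (LF + M) + M + LF)-lipschitz_on (UNIV \<inter> V p) (\<lambda>x. \<delta> n p x - F x)"
          by (rule lipschitz_on_subset) simp
      qed
      from lipschitz_on_add[OF this LF]
      show "(35 * C0 * (LF + M) + M + LF + \<epsilon> / 8 + LF)-lipschitz_on UNIV (glue \<delta>)" by simp
    qed
  qed
qed

theorem theorem3p3:
  fixes C0 :: real
  assumes "star_const TYPE('a::banach) C0"
  shows "\<exists>C1\<ge>C0. C1_prop TYPE('a) C0 C1 \<and>
    (\<forall>(Y::'a set) (f::'a \<Rightarrow> real) (D::'a \<Rightarrow> 'a \<Rightarrow> real) (F::'a \<Rightarrow> real) \<epsilon>.
       closed Y \<and> cont_dual_map Y D \<and> condE Y f D \<and>
       continuous_on UNIV F \<and> (\<forall>y\<in>Y. F y = f y) \<and> \<epsilon> > 0 \<longrightarrow>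
       (\<exists>G G'. C1_deriv G G' \<and>
          (\<forall>x. \<bar>F x - G x\<bar> < \<epsilon>) \<and>
          (\<forall>y\<in>Y. dual_norm (Zsp Y) (\<lambda>z. D y z - G' y z) < \<epsilon>) \<and>
          (\<exists>L<\<epsilon>. L-lipschitz_on Y (\<lambda>y. f y - G y)) \<and>
          (((\<exists>Lf. Lf-lipschitz_on Y f) \<and> (\<exists>LF. LF-lipschitz_on UNIV F) \<and>
            bdd_above ((\<lambda>y. dual_norm (Zsp Y) (D y)) ` Y)) \<longrightarrow>
             (\<epsilon> / 4 + (1 + C1) * Sup (insert 0 ((\<lambda>y. dual_norm (Zsp Y) (D y)) ` Y))
                  + C1 * lip UNIV F)-lipschitz_on UNIV G)))"
proof -
  define c where "c = 35 * max C0 0"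
  have c: "0 \<le> c" unfolding c_def by simp
  have star: "star_const TYPE('a) (max C0 0)" by (rule star_const_max[OF assms])
  \<comment> \<open>The witness \<open>c + 2\<close>: the 2 absorbs the two extra copies of
    \<open>lip UNIV F\<close>, and the extra \<open>M\<close> fits into the factor
    \<open>1 + C1\<close>.\<close>
  show ?thesis
  proof (intro exI[of _ "c + 2"] conjI allI impI)
    show "C0 \<le> c + 2" unfolding c_def by simp
    show "C1_prop TYPE('a) C0 (c + 2)"
      unfolding c_def by (rule C1_prop_mono[OF C1_prop_of_star_const[OF assms]]) simp
    fix Y :: "'a set" and f :: "'a \<Rightarrow> real" and D :: "'a \<Rightarrow> 'a \<Rightarrow> real" and F :: "'a \<Rightarrow> real"
      and \<epsilon> :: real
    assume "closed Y \<and> cont_dual_map Y D \<and> condE Y f D \<and>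
       continuous_on UNIV F \<and> (\<forall>y\<in>Y. F y = f y) \<and> \<epsilon> > 0"
    then have asms: "closed Y" "cont_dual_map Y D" "condE Y f D" "continuous_on UNIV F"
      "\<forall>y\<in>Y. F y = f y" "\<epsilon> > 0" by auto
    define S where "S = (\<lambda>y. dual_norm (Zsp Y) (D y)) ` Y"
    \<comment> \<open>The inserted 0 makes \<open>M\<close> nonnegative also when \<open>Y\<close>
      is empty.\<close>
    define M where "M = Sup (insert 0 S)"
    define P where "P \<longleftrightarrow> (\<exists>LF. LF-lipschitz_on UNIV F) \<and> bdd_above S"
    have lipF: "(lip UNIV F)-lipschitz_on UNIV F" if P
      using that lipschitz_on_lip unfolding P_def by blast
    have M0: "0 \<le> M" and M: "\<And>y. y \<in> Y \<Longrightarrow> dual_norm (Zsp Y) (D y) \<le> M" if P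
      using that unfolding M_def P_def by (auto intro!: cSup_upper simp: S_def)
    obtain G G' where G: "C1_deriv G G'" "\<forall>x. \<bar>F x - G x\<bar> < \<epsilon>"
      "\<forall>y\<in>Y. dual_norm (Zsp Y) (\<lambda>z. D y z - G' y z) < \<epsilon>"
      "(\<epsilon> / 4)-lipschitz_on Y (\<lambda>y. f y - G y)"
      and "P \<longrightarrow> (35 * max C0 0 * (lip UNIV F + M) + M + lip UNIV F + \<epsilon> / 8 + lip UNIV F)-lipschitz_on UNIV G"
      by (rule smooth_approximation_nonneg[OF star max.cobounded2 asms lipF M0 M])
    note lipG = \<open>P \<longrightarrow> _\<close>[folded c_def]
    have lip: "(\<epsilon> / 4 + (1 + (c + 2)) * M + (c + 2) * lip UNIV F)-lipschitz_on UNIV G" if P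
    proof (rule lipschitz_on_mono[OF lipG[rule_format, OF that] subset_refl])
      show "c * (lip UNIV F + M) + M + lip UNIV F + \<epsilon> / 8 + lip UNIV F
          \<le> \<epsilon> / 4 + (1 + (c + 2)) * M + (c + 2) * lip UNIV F"
        using M0[OF that] asms(6) by (simp add: algebra_simps)
    qed
    show "\<exists>G G'. C1_deriv G G' \<and> (\<forall>x. \<bar>F x - G x\<bar> < \<epsilon>) \<and>
          (\<forall>y\<in>Y. dual_norm (Zsp Y) (\<lambda>z. D y z - G' y z) < \<epsilon>) \<and>
          (\<exists>L<\<epsilon>. L-lipschitz_on Y (\<lambda>y. f y - G y)) \<and>
          (((\<exists>Lf. Lf-lipschitz_on Y f) \<and> (\<exists>LF. LF-lipschitz_on UNIV F) \<and>
            bdd_above ((\<lambda>y. dual_norm (Zsp Y) (D y)) ` Y)) \<longrightarrow>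
             (\<epsilon> / 4 + (1 + (c + 2)) * Sup (insert 0 ((\<lambda>y. dual_norm (Zsp Y) (D y)) ` Y))
                  + (c + 2) * lip UNIV F)-lipschitz_on UNIV G)"
    proof (intro exI[of _ G] exI[of _ G'] conjI impI G(1-3))
      show "\<exists>L<\<epsilon>. L-lipschitz_on Y (\<lambda>y. f y - G y)"
        using G(4) asms(6) by (intro exI[of _ "\<epsilon> / 4"]) auto
      assume "(\<exists>Lf. Lf-lipschitz_on Y f) \<and> (\<exists>LF. LF-lipschitz_on UNIV F) \<and>
          bdd_above ((\<lambda>y. dual_norm (Zsp Y) (D y)) ` Y)"
      then have P unfolding P_def S_def by (elim conjE) (intro conjI)
      from lip[OF this]
      show "(\<epsilon> / 4 + (1 + (c + 2)) * Sup (insert 0 ((\<lambda>y. dual_norm (Zsp Y) (D y)) ` Y))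
                  + (c + 2) * lip UNIV F)-lipschitz_on UNIV G"
        unfolding M_def S_def .
    qed
  qed
qed

end
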